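(* Let $(T,\mathcal{F},\mu)$ be a $\sigma$-finite measure space with $\mu(T)>0$, let $Y$ be a reflexive real Banach space, let $p>0$, and let $\varphi,\psi:Y\to\mathbb{R}$ be two sequentially weakly lower semicontinuous functionals such that $$\inf_{y\in Y}\frac{\min\{\varphi(y),\psi(y)\}}{1+\|y\|^p}>-\infty .$$ Let $a,b\in[0,+\infty]$ with $a<b$, and let $\alpha,\beta$ be defined by $$\alpha=\max\Big\{\inf_Y\psi,\ \sup_{M_b}\psi\Big\},\qquad \beta=\min\Big\{\sup_Y\psi,\ \inf_{M_a}\psi\Big\}$$ (with $M_a,M_b$ as in the context). Assume that the functional $\varphi+\lambda\psi$ is coercive and has a unique global minimum for each $\lambda\in\,]a,b[$, and that $\alpha<\beta$. Then, for each $\gamma\in L^\infty(T)\cap L^1(T)\setminus\{0\}$ with $\gamma\ge 0$, and for each $r\in\,]\alpha,\beta[$, if we put $$V_{\gamma,r}=\Big\{u\in L^p(T,Y):\ \int_T\gamma(t)\psi(u(t))\,d\mu\le r\int_T\gamma(t)\,d\mu\Big\},$$ we have $$\inf_{u\in V_{\gamma,r}}\int_T\gamma(t)\varphi(u(t))\,d\mu=\inf_{\psi^{-1}(r)}\varphi\ \int_T\gamma(t)\,d\mu .$$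
   Context: For $\lambda\in[0,+\infty]$, $M_\lambda$ denotes the set of all global minima (global minimum points in $Y$) of $\varphi+\lambda\psi$ if $\lambda<+\infty$, and $M_\lambda=\emptyset$ if $\lambda=+\infty$. Conventions: $\inf\emptyset=+\infty$, $\sup\emptyset=-\infty$. "Has a unique global minimum" means that there is exactly one global minimum point. A functional $P:Y\to\mathbb{R}$ is coercive if $\lim_{\|y\|\to+\infty}P(y)=+\infty$. $L^p(T,Y)$ is the space of all $\mu$-strongly measurable functions $u:T\to Y$ with $\int_T\|u(t)\|^p\,d\mu<+\infty$. The integrals $\int_T\gamma(t)\varphi(u(t))\,d\mu$ and $\int_T\gamma(t)\psi(u(t))\,d\mu$ take values in $]-\infty,+\infty]$. $]a,b[$ denotes an open interval, and $\psi^{-1}(r)=\{y\in Y:\psi(y)=r\}$. *)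

theory Defs
  imports "HOL-Analysis.Analysis"
begin

definition reflexive_space :: "'b::real_normed_vector itself \<Rightarrow> bool" where
  "reflexive_space _ \<longleftrightarrow>
    (\<forall>F :: ('b \<Rightarrow>\<^sub>L real) \<Rightarrow>\<^sub>L real. \<exists>y::'b. \<forall>f. blinfun_apply F f = blinfun_apply f y)"

definition weakly_converges :: "(nat \<Rightarrow> 'b::real_normed_vector) \<Rightarrow> 'b \<Rightarrow> bool" where
  "weakly_converges X x \<longleftrightarrow>
    (\<forall>f :: 'b \<Rightarrow>\<^sub>L real. (\<lambda>n. blinfun_apply f (X n)) \<longlonglongrightarrow> blinfun_apply f x)"

definition seq_weakly_lsc :: "('b::real_normed_vector \<Rightarrow> real) \<Rightarrow> bool" where
  "seq_weakly_lsc P \<longleftrightarrow>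
    (\<forall>X x. weakly_converges X x \<longrightarrow> ereal (P x) \<le> liminf (\<lambda>n. ereal (P (X n))))"

definition coercive :: "('b::real_normed_vector \<Rightarrow> real) \<Rightarrow> bool" where
  "coercive P \<longleftrightarrow> filterlim P at_top at_infinity"

definition global_minima :: "('b \<Rightarrow> real) \<Rightarrow> 'b set" where
  "global_minima P = {y. \<forall>z. P y \<le> P z}"

definition M_set :: "('b \<Rightarrow> real) \<Rightarrow> ('b \<Rightarrow> real) \<Rightarrow> ereal \<Rightarrow> 'b set" where
  "M_set \<phi> \<psi> l =
    (if l = \<infinity> then {} else global_minima (\<lambda>y. \<phi> y + real_of_ereal l * \<psi> y))"

(* Borel measurability would be too weak here: the space of values need not be separable. *)
definition strongly_measurable :: "'t measure \<Rightarrow> ('t \<Rightarrow> 'b::real_normed_vector) \<Rightarrow> bool" where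
  "strongly_measurable M u \<longleftrightarrow>
    (\<exists>s. (\<forall>n::nat. simple_function M (s n)) \<and> (AE t in M. (\<lambda>n. s n t) \<longlonglongrightarrow> u t))"

definition Lp_space :: "real \<Rightarrow> 't measure \<Rightarrow> ('t \<Rightarrow> 'b::real_normed_vector) set" where
  "Lp_space p M =
    {u. strongly_measurable M u \<and> (\<integral>\<^sup>+t. ennreal (norm (u t) powr p) \<partial>M) < \<infinity>}"

(* Since ennreal truncates negative reals to 0, these are the integrals of the positive and
   negative parts.  The value is the usual integral in ]-infinity, +infinity] when f agrees
   almost everywhere with a measurable function and its negative part has finite integral. *)
definition extended_integral :: "'t measure \<Rightarrow> ('t \<Rightarrow> real) \<Rightarrow> ereal" where
  "extended_integral M f =
    enn2ereal (\<integral>\<^sup>+t. ennreal (f t) \<partial>M) - enn2ereal (\<integral>\<^sup>+t. ennreal (- f t) \<partial>M)"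

definition V_set ::
  "'t measure \<Rightarrow> real \<Rightarrow> ('b::real_normed_vector \<Rightarrow> real) \<Rightarrow> ('t \<Rightarrow> real) \<Rightarrow> real \<Rightarrow> ('t \<Rightarrow> 'b) set" where
  "V_set M p \<psi> \<gamma> r =
    {u \<in> Lp_space p M.
      extended_integral M (\<lambda>t. \<gamma> t * \<psi> (u t)) \<le> ereal (r * (\<integral>t. \<gamma> t \<partial>M))}"

end

theory Submission
  imports Defs "HOL-Library.Diagonal_Subsequence"
begin

text \<open>The theorem is a Lagrange multiplier principle without a duality gap.  Suppose that for some \<open>l \<ge> 0\<close>
the functional \<open>\<phi> + l \<psi>\<close> has a global minimum point \<open>y1\<close> with \<open>\<psi> y1 = r\<close>.  Then
\<open>\<phi> y1 + l r \<le> \<phi> y + l \<psi> y\<close> for all \<open>y\<close>, so \<open>\<phi> y1\<close> is the minimum of \<open>\<phi>\<close> on the level \<open>r\<close> of \<open>\<psi>\<close>; and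
integrating this inequality along any \<open>u\<close> that satisfies the integral constraint shows that
\<open>\<phi> y1\<close> times the integral of \<open>\<gamma>\<close> is a lower bound (\<open>multiplier_lower_bound\<close>).  The lower bound is
approached by functions that equal \<open>y1\<close> except on a set of small weight; when the measure is
infinite a nonzero constant \<open>y1\<close> is not \<open>p\<close>-integrable, and the error made by cutting it off is
compensated by a point \<open>y0\<close> with \<open>\<psi> y0 < r\<close> (\<open>exists_near_constant_competitor\<close>).

The multiplier comes from an intermediate value argument (\<open>exists_multiplier\<close>).  The value of \<open>\<psi>\<close> at
the minimum point of \<open>\<phi> + l \<psi>\<close> is a nonincreasing function of \<open>l\<close>.  It is continuous because weak
limits of minimum points are minimum points and these are unique (\<open>limit_of_minimizers\<close>), and the
definitions of \<open>\<alpha>\<close> and \<open>\<beta>\<close> prevent it from staying above or below \<open>r\<close> near the ends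
of the interval: otherwise a limit of minimum points would be a global minimum point for \<open>a\<close> or \<open>b\<close>
with a value of \<open>\<psi>\<close> on the wrong side of \<open>r\<close>, or, for \<open>b = \<infinity>\<close>, large multipliers would favour \<open>y0\<close>.

Weak limits exist because bounded sequences in a reflexive space have weakly convergent
subsequences (\<open>reflexive_bounded_imp_weakly_convergent_subsequence\<close>).  This is derived from one form of
the Hahn-Banach theorem (\<open>exists_linear_supporting_sublinear\<close>), whose proof takes minimal elements
among the sublinear functionals below a given one.\<close>

section \<open>Sublinear functionals and their linear minorants\<close>

text \<open>Only the inequality is asked for under scaling; applied to \<open>c\<close> and to \<open>1 / c\<close> it gives positive
homogeneity (\<open>sublinear_scale\<close>), and in proofs one inequality is enough.\<close>
definition sublinear :: "('a::real_vector \<Rightarrow> real) \<Rightarrow> bool" where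
  "sublinear p \<longleftrightarrow>
    (\<forall>x y. p (x + y) \<le> p x + p y) \<and> (\<forall>c>0. \<forall>x. p (c *\<^sub>R x) \<le> c * p x)"

lemma sublinear_add: "sublinear p \<Longrightarrow> p (x + y) \<le> p x + p y"
  by (simp add: sublinear_def)

lemma sublinear_scale_le: "sublinear p \<Longrightarrow> c > 0 \<Longrightarrow> p (c *\<^sub>R x) \<le> c * p x"
  by (simp add: sublinear_def)

lemma sublinear_zero:
  assumes "sublinear p"
  shows "p 0 = 0"
  using sublinear_scale_le[OF assms, of 2 0] sublinear_scale_le[OF assms, of "1/2" 0] by simp

lemma sublinear_scale:
  assumes "sublinear p" and "c \<ge> 0"
  shows "p (c *\<^sub>R x) = c * p x"
proof (cases "c = 0")
  case True
  then show ?thesis by (simp add: sublinear_zero[OF assms(1)])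
next
  case False
  then have c: "c > 0" using assms(2) by simp
  have "p (inverse c *\<^sub>R (c *\<^sub>R x)) \<le> inverse c * p (c *\<^sub>R x)"
    using c by (intro sublinear_scale_le[OF assms(1)]) simp
  then have "p x \<le> inverse c * p (c *\<^sub>R x)" using c by simp
  then have "c * p x \<le> p (c *\<^sub>R x)"
    using c by (simp add: field_simps)
  with sublinear_scale_le[OF assms(1) c] show ?thesis by (simp add: antisym)
qed

lemma sublinear_neg_bound:
  assumes "sublinear p"
  shows "- p (- x) \<le> p x"
  using sublinear_add[OF assms, of x "- x"] sublinear_zero[OF assms] by simp

text \<open>The largest sublinear minorant of \<open>p\<close> whose value at \<open>- z\<close> is at most \<open>- p z\<close>.  A linear functional
below it attains \<open>p\<close> at \<open>z\<close>, and a sublinear functional that equals all its modifications of this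
kind is additive.\<close>
definition directional :: "('a::real_vector \<Rightarrow> real) \<Rightarrow> 'a \<Rightarrow> 'a \<Rightarrow> real" where
  "directional p z x = (INF t\<in>{0..}. p (x + t *\<^sub>R z) - t * p z)"

lemma directional_lower_bound:
  assumes "sublinear p" and "t \<ge> 0"
  shows "- p (- x) \<le> p (x + t *\<^sub>R z) - t * p z"
  using sublinear_add[OF assms(1), of "x + t *\<^sub>R z" "- x"] sublinear_scale[OF assms, of z]
  by simp

lemma directional_le:
  assumes "sublinear p" and "t \<ge> 0"
  shows "directional p z x \<le> p (x + t *\<^sub>R z) - t * p z"
  unfolding directional_def
  by (rule cINF_lower)
    (use assms in \<open>auto intro!: bdd_belowI2[where m="- p (- x)"] directional_lower_bound\<close>)

lemma directional_greatest:
  assumes "\<And>t. t \<ge> 0 \<Longrightarrow> c \<le> p (x + t *\<^sub>R z) - t * p z"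
  shows "c \<le> directional p z x"
  unfolding directional_def using assms by (intro cINF_greatest) auto

lemma sublinear_directional:
  assumes p: "sublinear p"
  shows "sublinear (directional p z)"
  unfolding sublinear_def
proof (intro conjI allI impI)
  fix x y
  have *: "directional p z (x + y) - (p (y + t *\<^sub>R z) - t * p z) \<le> p (x + s *\<^sub>R z) - s * p z"
    if "s \<ge> 0" "t \<ge> 0" for s t
    using directional_le[OF p, of "s + t" z "x + y"] that
      sublinear_add[OF p, of "x + s *\<^sub>R z" "y + t *\<^sub>R z"]
    by (simp add: algebra_simps)
  have "directional p z (x + y) - directional p z x \<le> p (y + t *\<^sub>R z) - t * p z"
    if t: "t \<ge> 0" for t
    using directional_greatest[OF *[OF _ t]] by simp
  then have "directional p z (x + y) - directional p z x \<le> directional p z y"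
    by (rule directional_greatest)
  then show "directional p z (x + y) \<le> directional p z x + directional p z y" by simp
next
  fix c :: real and x assume c: "c > 0"
  have "directional p z (c *\<^sub>R x) / c \<le> p (x + t *\<^sub>R z) - t * p z" if t: "t \<ge> 0" for t
  proof -
    have "directional p z (c *\<^sub>R x) \<le> p (c *\<^sub>R (x + t *\<^sub>R z)) - c * t * p z"
      using directional_le[OF p, of "c * t" z "c *\<^sub>R x"] c t by (simp add: algebra_simps)
    also have "\<dots> = c * (p (x + t *\<^sub>R z) - t * p z)"
      using sublinear_scale[OF p, of c "x + t *\<^sub>R z"] c by (simp add: right_diff_distrib)
    finally show ?thesis using c by (simp add: field_simps)
  qed
  then have "directional p z (c *\<^sub>R x) / c \<le> directional p z x"
    by (rule directional_greatest)
  then show "directional p z (c *\<^sub>R x) \<le> c * directional p z x"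
    using c by (simp add: field_simps)
qed

text \<open>The lower bounds of chains required by Zorn's lemma.  The infimum is finite because every
minorant \<open>q\<close> of \<open>p\<close> satisfies \<open>q x \<ge> - p (- x)\<close>; it is subadditive because two members of a chain
can be replaced by the smaller one.\<close>
lemma sublinear_INF_chain:
  assumes C: "C \<noteq> {}" and sub: "\<And>q. q \<in> C \<Longrightarrow> sublinear q"
    and le: "\<And>q. q \<in> C \<Longrightarrow> q \<le> p"
    and chain: "\<And>q q'. q \<in> C \<Longrightarrow> q' \<in> C \<Longrightarrow> q \<le> q' \<or> q' \<le> q"
  shows "sublinear (\<lambda>x. INF q\<in>C. q x)" and "q \<in> C \<Longrightarrow> (\<lambda>x. INF q\<in>C. q x) \<le> q"
proof -
  define u where "u = (\<lambda>x. INF q\<in>C. q x)"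
  have lower: "u x \<le> q x" if "q \<in> C" for q x
    unfolding u_def
  proof (rule cINF_lower[OF _ that], rule bdd_belowI2)
    fix q assume "q \<in> C"
    then show "- p (- x) \<le> q x"
      using sublinear_neg_bound[OF sub, of q x] le_funD[OF le, of q "- x"] by simp
  qed
  have greatest: "c \<le> u x" if "\<And>q. q \<in> C \<Longrightarrow> c \<le> q x" for c x
    unfolding u_def using C that by (rule cINF_greatest)
  show "(\<lambda>x. INF q\<in>C. q x) \<le> q" if "q \<in> C"
    using lower[OF that] by (simp add: u_def le_fun_def)
  have "sublinear u"
    unfolding sublinear_def
  proof (intro conjI allI impI)
    fix x y
    have *: "u (x + y) - q' y \<le> q x" if q: "q \<in> C" "q' \<in> C" for q q'
    proof -
      obtain m where m: "m \<in> C" "m \<le> q" "m \<le> q'"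
        using chain[OF q] q by auto
      have "u (x + y) \<le> m x + m y"
        using lower[OF m(1), of "x + y"] sublinear_add[OF sub[OF m(1)], of x y] by simp
      with le_funD[OF m(2), of x] le_funD[OF m(3), of y] show ?thesis by simp
    qed
    have "u (x + y) - u x \<le> q' y" if "q' \<in> C" for q'
      using greatest[of "u (x + y) - q' y" x] *[OF _ that] by force
    then have "u (x + y) - u x \<le> u y" by (rule greatest)
    then show "u (x + y) \<le> u x + u y" by simp
  next
    fix c :: real and x assume c: "c > 0"
    have "u (c *\<^sub>R x) / c \<le> q x" if "q \<in> C" for q
      using lower[OF that, of "c *\<^sub>R x"] sublinear_scale_le[OF sub[OF that] c, of x] c
      by (simp add: field_simps)
    then have "u (c *\<^sub>R x) / c \<le> u x" by (rule greatest)
    then show "u (c *\<^sub>R x) \<le> c * u x"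
      using c by (simp add: field_simps)
  qed
  then show "sublinear (\<lambda>x. INF q\<in>C. q x)" by (simp add: u_def)
qed

text \<open>Minimality forces \<open>directional q z = q\<close>; evaluated at \<open>t = 1\<close> this says \<open>q x + q z \<le> q (x + z)\<close>, the
converse of subadditivity.\<close>
lemma minimal_sublinear_is_linear:
  assumes q: "sublinear q" and min: "\<And>q'. sublinear q' \<Longrightarrow> q' \<le> q \<Longrightarrow> q' = q"
  shows "linear q"
proof (rule linearI)
  have "directional q z \<le> q" for z
    using directional_le[OF q, of 0 z] by (auto simp: le_fun_def)
  then have dir: "directional q z = q" for z
    by (intro min sublinear_directional q)
  show add: "q (x + y) = q x + q y" for x y
    using directional_le[OF q, of 1 y x] sublinear_add[OF q, of x y] by (simp add: dir)
  have neg: "q (- x) = - q x" for x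
    using add[of x "- x"] sublinear_zero[OF q] by simp
  show "q (c *\<^sub>R x) = c *\<^sub>R q x" for c x
  proof (cases "c \<ge> 0")
    case True
    then show ?thesis by (simp add: sublinear_scale[OF q])
  next
    case False
    then have "q ((- c) *\<^sub>R x) = - c * q x" by (intro sublinear_scale[OF q]) simp
    then show ?thesis using neg[of "c *\<^sub>R x"] by simp
  qed
qed

lemma exists_linear_below_sublinear:
  assumes p: "sublinear p"
  shows "\<exists>f. linear f \<and> (\<forall>x. f x \<le> p x)"
proof -
  let ?A = "{q. sublinear q \<and> q \<le> p}"
  let ?P = "\<lambda>q q'. (q' :: 'a \<Rightarrow> real) \<le> q"
  have "\<exists>m\<in>?A. \<forall>q\<in>?A. ?P m q \<longrightarrow> q = m"
  proof (rule predicate_Zorn)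
    show "partial_order_on ?A (relation_of ?P ?A)"
      by (auto simp: partial_order_on_def preorder_on_def refl_on_def trans_def antisym_def
          relation_of_def)
    fix C assume "C \<in> Chains (relation_of ?P ?A)"
    then have C: "\<And>q. q \<in> C \<Longrightarrow> sublinear q" "\<And>q. q \<in> C \<Longrightarrow> q \<le> p"
      "\<And>q q'. q \<in> C \<Longrightarrow> q' \<in> C \<Longrightarrow> q \<le> q' \<or> q' \<le> q"
      by (auto simp: Chains_def relation_of_def)
    show "\<exists>u\<in>?A. \<forall>q\<in>C. ?P q u"
    proof (cases "C = {}")
      case True
      then show ?thesis using p by auto
    next
      case False
      then obtain q0 where q0: "q0 \<in> C" by auto
      have inf: "sublinear (\<lambda>x. INF q\<in>C. q x)" "q \<in> C \<Longrightarrow> (\<lambda>x. INF q\<in>C. q x) \<le> q" for q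
        by (rule sublinear_INF_chain[where p = p]; use False C in blast)+
      have "(\<lambda>x. INF q\<in>C. q x) \<le> p"
        using inf(2)[OF q0] C(2)[OF q0] by (rule order_trans)
      with inf show ?thesis by (intro bexI[of _ "\<lambda>x. INF q\<in>C. q x"]) auto
    qed
  qed
  then obtain m where m: "sublinear m" "m \<le> p"
    and min: "\<And>q. sublinear q \<Longrightarrow> q \<le> p \<Longrightarrow> q \<le> m \<Longrightarrow> q = m" by blast
  have "linear m"
    using m min by (intro minimal_sublinear_is_linear) (auto intro: order_trans)
  with m(2) show ?thesis by (auto simp: le_fun_def)
qed

text \<open>The Hahn-Banach theorem in the form used below.  The linear functional is sought below
\<open>directional p z\<close> instead of \<open>p\<close>, which forces equality at \<open>z\<close>.  Its three applications take for \<open>p\<close>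
the norm, the distance to a closed subspace, and, on the dual space, the upper limit along a
bounded sequence.\<close>
lemma exists_linear_supporting_sublinear:
  assumes p: "sublinear p"
  obtains f where "linear f" and "\<And>x. f x \<le> p x" and "f z = p z"
proof -
  obtain f where f: "linear f" "\<And>x. f x \<le> directional p z x"
    using exists_linear_below_sublinear[OF sublinear_directional[OF p]] by blast
  have le: "f x \<le> p x" for x
    using f(2)[of x] directional_le[OF p, of 0 z x] by simp
  have "f (- z) \<le> - p z"
    using f(2)[of "- z"] directional_le[OF p, of 1 z "- z"] sublinear_zero[OF p] by simp
  then have "f z = p z"
    using le[of z] linear_neg[OF f(1), of z] by simp
  with f(1) le show thesis by (rule that)
qed

section \<open>Weak sequential compactness in reflexive spaces\<close>

lemma sublinear_norm_bounded_linear: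
  assumes f: "linear f" and le: "\<And>x. f x \<le> K * norm x"
  shows "bounded_linear f"
proof (rule bounded_linear_intro[where K = K])
  show "f (x + y) = f x + f y" "f (c *\<^sub>R x) = c *\<^sub>R f x" for x y c
    using f by (simp_all add: linear_add linear_cmul)
  show "norm (f x) \<le> norm x * K" for x
    using le[of x] le[of "- x"] linear_neg[OF f, of x] by (simp add: abs_le_iff mult.commute)
qed

lemma exists_norming_functional:
  fixes x0 :: "'b::real_normed_vector"
  obtains f :: "'b \<Rightarrow>\<^sub>L real"
  where "\<And>x. \<bar>blinfun_apply f x\<bar> \<le> norm x" and "blinfun_apply f x0 = norm x0"
proof -
  have "sublinear (norm :: 'b \<Rightarrow> real)"
    by (auto simp: sublinear_def norm_triangle_ineq)
  then obtain f where f: "linear f" "\<And>x. f x \<le> norm x" "f x0 = norm x0"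
    using exists_linear_supporting_sublinear[where z = x0] by blast
  have "bounded_linear f"
    using f by (intro sublinear_norm_bounded_linear[where K = 1]) auto
  then have eq: "blinfun_apply (Blinfun f) = f" by (rule bounded_linear_Blinfun_apply)
  have "\<bar>f x\<bar> \<le> norm x" for x
    using f(2)[of x] f(2)[of "- x"] linear_neg[OF f(1), of x] by (simp add: abs_le_iff)
  with f(3) show thesis by (intro that[of "Blinfun f"]) (simp_all add: eq)
qed

lemma sublinear_infdist:
  fixes S :: "'b::real_normed_vector set"
  assumes S: "subspace S"
  shows "sublinear (\<lambda>x. infdist x S)"
proof -
  have ne: "S \<noteq> {}" using subspace_0[OF S] by auto
  have le: "infdist x S \<le> norm (x - s)" if "s \<in> S" for x s
    using infdist_le[OF that, of x] by (simp add: dist_norm)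
  have greatest: "c \<le> infdist x S" if "\<And>s. s \<in> S \<Longrightarrow> c \<le> norm (x - s)" for c x
    unfolding infdist_notempty[OF ne] dist_norm by (intro cINF_greatest ne that)
  show ?thesis
    unfolding sublinear_def
  proof (intro conjI allI impI)
    fix x y
    have *: "infdist (x + y) S - norm (y - t) \<le> norm (x - s)" if "s \<in> S" "t \<in> S" for s t
      using le[OF subspace_add[OF S that], of "x + y"] norm_triangle_ineq[of "x - s" "y - t"]
      by (simp add: algebra_simps)
    have "infdist (x + y) S - infdist x S \<le> norm (y - t)" if "t \<in> S" for t
      using greatest[OF *[OF _ that]] by simp
    from greatest[OF this] show "infdist (x + y) S \<le> infdist x S + infdist y S" by simp
  next
    fix c :: real and x assume c: "c > 0"
    have "infdist (c *\<^sub>R x) S / c \<le> norm (x - s)" if "s \<in> S" for s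
    proof -
      have "infdist (c *\<^sub>R x) S \<le> norm (c *\<^sub>R (x - s))"
        using le[OF subspace_scale[OF S that, of c], of "c *\<^sub>R x"] by (simp only: scaleR_diff_right)
      then have "infdist (c *\<^sub>R x) S \<le> c * norm (x - s)" using c by simp
      then show ?thesis using c by (simp add: field_simps)
    qed
    from greatest[OF this] show "infdist (c *\<^sub>R x) S \<le> c * infdist x S"
      using c by (simp add: field_simps)
  qed
qed

lemma closed_subspace_separation:
  fixes S :: "'b::real_normed_vector set"
  assumes S: "subspace S" "closed S" and x0: "x0 \<notin> S"
  obtains f :: "'b \<Rightarrow>\<^sub>L real"
  where "\<And>x. x \<in> S \<Longrightarrow> blinfun_apply f x = 0" and "blinfun_apply f x0 \<noteq> 0"
proof -
  have ne: "S \<noteq> {}" using subspace_0[OF S(1)] by auto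
  obtain f where f: "linear f" "\<And>x. f x \<le> infdist x S" "f x0 = infdist x0 S"
    using exists_linear_supporting_sublinear[OF sublinear_infdist[OF S(1)], where z = x0] by blast
  have "f x \<le> 1 * norm x" for x
    using f(2)[of x] infdist_le[OF subspace_0[OF S(1)], of x] by simp
  with f(1) have "bounded_linear f" by (rule sublinear_norm_bounded_linear)
  then have eq: "blinfun_apply (Blinfun f) = f" by (rule bounded_linear_Blinfun_apply)
  have "f x = 0" if "x \<in> S" for x
    using f(2)[of x] f(2)[of "- x"] that subspace_neg[OF S(1) that] linear_neg[OF f(1), of x]
    by simp
  moreover have "f x0 \<noteq> 0"
    using f(3) x0 S(2) in_closed_iff_infdist_zero[OF S(2) ne, of x0] by simp
  ultimately show thesis by (intro that[of "Blinfun f"]) (simp_all add: eq)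
qed

text \<open>A countable set with the same closed span as the sequence.  Coefficient lists make both its
countability and its closure under sums (concatenation) immediate.\<close>
definition rational_combinations :: "(nat \<Rightarrow> 'b::real_vector) \<Rightarrow> 'b set" where
  "rational_combinations X =
    range (\<lambda>l :: (rat \<times> nat) list. sum_list (map (\<lambda>(q, i). real_of_rat q *\<^sub>R X i) l))"

lemma countable_rational_combinations: "countable (rational_combinations X)"
  by (simp add: rational_combinations_def)

lemma closure_rational_combinations:
  fixes X :: "nat \<Rightarrow> 'b::real_normed_vector"
  shows "subspace (closure (rational_combinations X))" and "X i \<in> rational_combinations X"
proof -
  let ?D = "rational_combinations X"
  define c where "c = (\<lambda>l :: (rat \<times> nat) list. sum_list (map (\<lambda>(q, i). real_of_rat q *\<^sub>R X i) l))"
  have D: "?D = range c" by (simp add: rational_combinations_def c_def)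
  have "X i = c [(1, i)]" by (simp add: c_def)
  then show "X i \<in> ?D" unfolding D by blast
  have "0 = c []" by (simp add: c_def)
  then have zero: "0 \<in> ?D" unfolding D by blast
  have add: "x + y \<in> ?D" if xy: "x \<in> ?D" "y \<in> ?D" for x y
  proof -
    obtain l k where "x = c l" "y = c k"
      using xy unfolding D by blast
    then have "x + y = c (l @ k)" by (simp add: c_def)
    then show ?thesis unfolding D by blast
  qed
  have scale: "real_of_rat q *\<^sub>R x \<in> ?D" if xD: "x \<in> ?D" for q x
  proof -
    obtain l where x: "x = c l" using xD unfolding D by blast
    have "real_of_rat q *\<^sub>R c l = c (map (\<lambda>(r, i). (q * r, i)) l)"
      by (induction l) (auto simp: c_def scaleR_add_right of_rat_mult)
    then show ?thesis unfolding D x by blast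
  qed
  show "subspace (closure ?D)"
  proof (rule subspaceI)
    show "0 \<in> closure ?D" using zero closure_subset by blast
    show "x + y \<in> closure ?D" if xy: "x \<in> closure ?D" "y \<in> closure ?D" for x y
    proof -
      obtain f g where "\<And>n. f n \<in> ?D" "f \<longlonglongrightarrow> x" "\<And>n. g n \<in> ?D" "g \<longlonglongrightarrow> y"
        using xy unfolding closure_sequential by blast
      then show ?thesis
        unfolding closure_sequential
        by (intro exI[of _ "\<lambda>n. f n + g n"]) (auto intro: add tendsto_add)
    qed
    show "c *\<^sub>R x \<in> closure ?D" if x: "x \<in> closure ?D" for c x
    proof -
      obtain f where f: "\<And>n. f n \<in> ?D" "f \<longlonglongrightarrow> x"
        using x unfolding closure_sequential by blast
      have "\<exists>q. \<bar>real_of_rat q - c\<bar> < 1 / real (Suc n)" for n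
      proof -
        have "c - 1 / real (Suc n) < c + 1 / real (Suc n)" by simp
        then obtain q where "c - 1 / real (Suc n) < real_of_rat q"
          "real_of_rat q < c + 1 / real (Suc n)"
          using of_rat_dense by blast
        then have "\<bar>real_of_rat q - c\<bar> < 1 / real (Suc n)" by (simp only: abs_less_iff) linarith
        then show ?thesis ..
      qed
      then obtain q where q: "\<And>n. \<bar>real_of_rat (q n) - c\<bar> < 1 / real (Suc n)" by metis
      have "(\<lambda>n. 1 / real (Suc n)) \<longlonglongrightarrow> 0" by (intro LIMSEQ_Suc lim_1_over_n)
      moreover have "\<forall>\<^sub>F n in sequentially. norm (real_of_rat (q n) - c) \<le> 1 / real (Suc n)"
        using q by (intro always_eventually allI) (simp only: real_norm_def less_imp_le)
      ultimately have "(\<lambda>n. real_of_rat (q n) - c) \<longlonglongrightarrow> 0"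
        by (rule Lim_null_comparison[rotated])
      then have "(\<lambda>n. real_of_rat (q n)) \<longlonglongrightarrow> c" by (rule LIM_zero_cancel)
      then have "(\<lambda>n. real_of_rat (q n) *\<^sub>R f n) \<longlonglongrightarrow> c *\<^sub>R x"
        by (intro tendsto_scaleR f)
      then show ?thesis
        unfolding closure_sequential
        by (intro exI[of _ "\<lambda>n. real_of_rat (q n) *\<^sub>R f n"]) (auto intro: scale f)
    qed
  qed
qed

text \<open>Countably many functionals separate the points of a separable closed subspace: if \<open>d\<close> is
closer to \<open>z\<close> than half the norm of \<open>z\<close>, a functional norming \<open>d\<close> cannot vanish at \<open>z\<close>.\<close>
lemma norming_functionals_total:
  fixes D :: "'b::real_normed_vector set" and F :: "'b \<Rightarrow> 'b \<Rightarrow>\<^sub>L real"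
  assumes F: "\<And>d x. \<bar>blinfun_apply (F d) x\<bar> \<le> norm x" "\<And>d. blinfun_apply (F d) d = norm d"
    and z: "z \<in> closure D" "\<And>d. d \<in> D \<Longrightarrow> blinfun_apply (F d) z = 0"
  shows "z = 0"
proof (rule ccontr)
  assume "z \<noteq> 0"
  then obtain d where d: "d \<in> D" "dist d z < norm z / 2"
    using z(1) unfolding closure_approachable by (metis half_gt_zero zero_less_norm_iff)
  have "norm d = blinfun_apply (F d) (d - z)"
    using F(2)[of d] z(2)[OF d(1)] by (simp add: blinfun.diff_right)
  also have "\<dots> \<le> dist d z"
    using F(1)[of d "d - z"] by (simp add: dist_norm)
  finally show False
    using d(2) norm_triangle_ineq2[of z d] by (simp add: dist_norm norm_minus_commute)
qed

lemma diagonal_convergence: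
  fixes f :: "nat \<Rightarrow> nat \<Rightarrow> real"
  assumes bdd: "\<And>k. \<exists>C. \<forall>n. \<bar>f k n\<bar> \<le> C"
  obtains s where "strict_mono s" and "\<And>k. convergent (\<lambda>n. f k (s n))"
proof -
  interpret subseqs "\<lambda>k s. convergent (\<lambda>n. f k (s n))"
  proof
    fix k and s :: "nat \<Rightarrow> nat" assume "strict_mono s"
    obtain C where "\<forall>n. \<bar>f k n\<bar> \<le> C" using bdd by blast
    then have "bounded (range (\<lambda>n. f k (s n)))" by (auto intro!: boundedI[where B = C])
    then obtain r l where "strict_mono r" "((\<lambda>n. f k (s n)) \<circ> r) \<longlonglongrightarrow> l"
      using bounded_imp_convergent_subsequence by blast
    then show "\<exists>r. strict_mono r \<and> convergent (\<lambda>n. f k ((s \<circ> r) n))"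
      by (auto simp: convergent_def o_def)
  qed
  have "convergent (\<lambda>n. f k (diagseq n))" for k
  proof -
    have "convergent (\<lambda>n. f k ((diagseq \<circ> (+) (Suc k)) n))"
    proof (rule diagseq_holds)
      fix r s :: "nat \<Rightarrow> nat" and n
      assume "strict_mono r" "convergent (\<lambda>i. f n (s i))"
      then show "convergent (\<lambda>i. f n ((s \<circ> r) i))"
        using convergent_subseq_convergent[of "\<lambda>i. f n (s i)" r] by (simp add: o_def)
    qed
    then have "convergent (\<lambda>n. f k (diagseq (n + Suc k)))" by (simp add: add.commute)
    then show ?thesis by (subst (asm) convergent_ignore_initial_segment)
  qed
  with subseq_diagseq show thesis by (rule that)
qed

text \<open>The limit superior of a bounded sequence, as a real number.\<close>
definition upper_limit :: "(nat \<Rightarrow> real) \<Rightarrow> real" where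
  "upper_limit x = Inf {c. \<forall>\<^sub>F n in sequentially. x n \<le> c}"

lemma
  assumes x: "\<And>n. \<bar>x n\<bar> \<le> K"
  shows upper_limit_le: "\<forall>\<^sub>F n in sequentially. x n \<le> c \<Longrightarrow> upper_limit x \<le> c"
    and upper_limit_eventually: "e > 0 \<Longrightarrow> \<forall>\<^sub>F n in sequentially. x n \<le> upper_limit x + e"
proof -
  let ?S = "{c. \<forall>\<^sub>F n in sequentially. x n \<le> c}"
  have "- K \<le> c" if "c \<in> ?S" for c
  proof -
    have "\<forall>\<^sub>F n in sequentially. x n \<le> c" using that by simp
    then obtain n where "x n \<le> c" using eventually_happens by fastforce
    with x[of n] show ?thesis by simp
  qed
  then have bdd: "bdd_below ?S" by (rule bdd_belowI)
  show "upper_limit x \<le> c" if "\<forall>\<^sub>F n in sequentially. x n \<le> c"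
    unfolding upper_limit_def using that bdd by (intro cInf_lower) auto
  have "x n \<le> K" for n using x[of n] by simp
  then have "K \<in> ?S" by simp
  then have ne: "?S \<noteq> {}" by blast
  show "\<forall>\<^sub>F n in sequentially. x n \<le> upper_limit x + e" if "e > 0"
  proof -
    have "Inf ?S < upper_limit x + e" using that by (simp add: upper_limit_def)
    then obtain c where c: "c \<in> ?S" "c < upper_limit x + e"
      using cInf_lessD[OF ne] by blast
    from c(1) have "\<forall>\<^sub>F n in sequentially. x n \<le> c" by simp
    then show ?thesis by eventually_elim (use c(2) in simp)
  qed
qed

lemma sublinear_upper_limit:
  fixes X :: "nat \<Rightarrow> 'b::real_normed_vector"
  assumes bdd: "\<And>n. norm (X n) \<le> K"
  shows "sublinear (\<lambda>f :: 'b \<Rightarrow>\<^sub>L real. upper_limit (\<lambda>n. blinfun_apply f (X n)))"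
    and "\<bar>blinfun_apply f (X n)\<bar> \<le> norm f * K"
proof -
  have b: "\<bar>blinfun_apply f (X n)\<bar> \<le> norm f * K" for f :: "'b \<Rightarrow>\<^sub>L real" and n
    using norm_blinfun[of f "X n"] mult_left_mono[OF bdd[of n], of "norm f"] by simp
  then show "\<bar>blinfun_apply f (X n)\<bar> \<le> norm f * K" .
  let ?p = "\<lambda>f :: 'b \<Rightarrow>\<^sub>L real. upper_limit (\<lambda>n. blinfun_apply f (X n))"
  have le: "?p f \<le> c" if "\<forall>\<^sub>F n in sequentially. blinfun_apply f (X n) \<le> c" for f c
    using that by (rule upper_limit_le[OF b[of f]])
  have ev: "\<forall>\<^sub>F n in sequentially. blinfun_apply f (X n) \<le> ?p f + e" if "e > 0" for f e
    using that by (rule upper_limit_eventually[OF b[of f]])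
  show "sublinear ?p"
    unfolding sublinear_def
  proof (intro conjI allI impI)
    fix f g :: "'b \<Rightarrow>\<^sub>L real"
    show "?p (f + g) \<le> ?p f + ?p g"
    proof (rule field_le_epsilon)
      fix e :: real assume e: "e > 0"
      have "\<forall>\<^sub>F n in sequentially. blinfun_apply (f + g) (X n) \<le> ?p f + ?p g + e"
        using ev[OF half_gt_zero[OF e], of f] ev[OF half_gt_zero[OF e], of g]
        by eventually_elim (simp add: blinfun.add_left)
      then show "?p (f + g) \<le> ?p f + ?p g + e" by (rule le)
    qed
  next
    fix c :: real and f :: "'b \<Rightarrow>\<^sub>L real" assume c: "c > 0"
    show "?p (c *\<^sub>R f) \<le> c * ?p f"
    proof (rule field_le_epsilon)
      fix e :: real assume e: "e > 0"
      have "\<forall>\<^sub>F n in sequentially. blinfun_apply (c *\<^sub>R f) (X n) \<le> c * ?p f + e"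
        using ev[of "e/c" f] e c
        by (auto elim!: eventually_mono simp: blinfun.scaleR_left field_simps)
      then show "?p (c *\<^sub>R f) \<le> c * ?p f + e" by (rule le)
    qed
  qed
qed

text \<open>A linear functional on the dual below the upper limit is bounded, so reflexivity represents it by
a point of the space.  This replaces the extraction of a weakly convergent subnet; the choice of
the supporting functional prescribes the value at one functional \<open>g\<close>.\<close>
lemma exists_point_attaining_upper_limit:
  fixes X :: "nat \<Rightarrow> 'b::real_normed_vector" and g :: "'b \<Rightarrow>\<^sub>L real"
  assumes refl: "reflexive_space TYPE('b)" and bdd: "\<And>n. norm (X n) \<le> K"
  obtains y where "\<And>f. blinfun_apply f y \<le> upper_limit (\<lambda>n. blinfun_apply f (X n))"
    and "blinfun_apply g y = upper_limit (\<lambda>n. blinfun_apply g (X n))"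
proof -
  let ?p = "\<lambda>f :: 'b \<Rightarrow>\<^sub>L real. upper_limit (\<lambda>n. blinfun_apply f (X n))"
  note b = sublinear_upper_limit(2)[of X, OF bdd]
  obtain G where G: "linear G" "\<And>f. G f \<le> ?p f" "G g = ?p g"
    by (rule exists_linear_supporting_sublinear[OF sublinear_upper_limit(1)[of X, OF bdd],
          where z = g]) (rule that)
  have "G f \<le> K * norm f" for f
  proof -
    have "blinfun_apply f (X n) \<le> K * norm f" for n
      using b[of f n] by (simp add: mult.commute)
    then have "\<forall>\<^sub>F n in sequentially. blinfun_apply f (X n) \<le> K * norm f" by simp
    then have "?p f \<le> K * norm f" by (rule upper_limit_le[OF b[of f]])
    with G(2)[of f] show ?thesis by simp
  qed
  with G(1) have "bounded_linear G" by (rule sublinear_norm_bounded_linear)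
  then have eq: "blinfun_apply (Blinfun G) = G" by (rule bounded_linear_Blinfun_apply)
  obtain y where "\<forall>f. blinfun_apply (Blinfun G) f = blinfun_apply f y"
    using refl[unfolded reflexive_space_def, rule_format, of "Blinfun G"] by auto
  then have "\<And>f. G f = blinfun_apply f y" by (simp add: eq)
  with G(2,3) show thesis by (intro that[of y]) simp_all
qed

text \<open>A diagonal argument gives a subsequence along which countably many norming functionals of the
closed span of the sequence converge.  Every point whose evaluations are dominated by the upper
limits lies in this closed span (a functional vanishing on the span has upper limit zero) and has
prescribed values at the norming functionals, so there is only one such point \<open>y\<close>.  On the other
hand the upper limit at any functional \<open>f\<close> is attained by some such point, hence by \<open>y\<close>; applied to
\<open>f\<close> and \<open>- f\<close> this is the convergence of \<open>f\<close> along the subsequence.\<close>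
lemma reflexive_bounded_imp_weakly_convergent_subsequence:
  fixes X :: "nat \<Rightarrow> 'b::real_normed_vector"
  assumes refl: "reflexive_space TYPE('b)" and bdd: "\<And>n. norm (X n) \<le> K"
  obtains s y where "strict_mono s" and "weakly_converges (X \<circ> s) y"
proof -
  let ?D = "rational_combinations X"
  have "\<exists>f :: 'b \<Rightarrow>\<^sub>L real. (\<forall>x. \<bar>blinfun_apply f x\<bar> \<le> norm x) \<and> blinfun_apply f d = norm d" for d
    using exists_norming_functional[of d] by metis
  then obtain F :: "'b \<Rightarrow> 'b \<Rightarrow>\<^sub>L real" where F:
    "\<And>d x. \<bar>blinfun_apply (F d) x\<bar> \<le> norm x" "\<And>d. blinfun_apply (F d) d = norm d" by metis
  have Dne: "?D \<noteq> {}" using closure_rational_combinations(2)[of X 0] by auto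
  obtain s where s: "strict_mono s"
    "\<And>k. convergent (\<lambda>n. blinfun_apply (F (from_nat_into ?D k)) (X (s n)))"
  proof (rule diagonal_convergence[of "\<lambda>k n. blinfun_apply (F (from_nat_into ?D k)) (X n)"])
    show "\<exists>C. \<forall>n. \<bar>blinfun_apply (F (from_nat_into ?D k)) (X n)\<bar> \<le> C" for k
      by (rule exI[of _ K], intro allI order_trans[OF F(1) bdd])
  qed metis
  define x where "x = X \<circ> s"
  have xb: "norm (x n) \<le> K" for n by (simp add: x_def bdd)
  note b = sublinear_upper_limit(2)[of x, OF xb]
  have conv: "convergent (\<lambda>n. blinfun_apply (F d) (x n))" if "d \<in> ?D" for d
  proof -
    obtain k where "from_nat_into ?D k = d"
      using from_nat_into_surj[OF countable_rational_combinations \<open>d \<in> ?D\<close>] by blast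
    with s(2)[of k] show ?thesis by (simp add: x_def)
  qed
  have upper_limit: "\<forall>\<^sub>F n in sequentially. blinfun_apply f (x n) \<le> blinfun_apply f y + e"
    if "blinfun_apply f y = upper_limit (\<lambda>n. blinfun_apply f (x n))" "e > 0" for f y e
    using upper_limit_eventually[OF b[of f] that(2)] that(1) by simp
  \<comment> \<open>the dominated points lie in the closed span and agree at the norming functionals\<close>
  have determined: "y \<in> closure ?D \<and> (\<forall>d\<in>?D. (\<lambda>n. blinfun_apply (F d) (x n)) \<longlonglongrightarrow> blinfun_apply (F d) y)"
    if y: "\<And>f. blinfun_apply f y \<le> upper_limit (\<lambda>n. blinfun_apply f (x n))" for y
  proof (intro conjI ballI)
    have le: "blinfun_apply f y \<le> L" if L: "(\<lambda>n. blinfun_apply f (x n)) \<longlonglongrightarrow> L" for f :: "'b \<Rightarrow>\<^sub>L real" and L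
    proof (rule field_le_epsilon)
      fix e :: real assume "e > 0"
      then have "\<forall>\<^sub>F n in sequentially. blinfun_apply f (x n) < L + e"
        using order_tendstoD(2)[OF L] by simp
      then have "\<forall>\<^sub>F n in sequentially. blinfun_apply f (x n) \<le> L + e"
        by (rule eventually_mono) simp
      from upper_limit_le[OF b[of f] this] y[of f] show "blinfun_apply f y \<le> L + e" by simp
    qed
    have eq: "blinfun_apply f y = L" if L: "(\<lambda>n. blinfun_apply f (x n)) \<longlonglongrightarrow> L" for f :: "'b \<Rightarrow>\<^sub>L real" and L
      using le[OF L] le[of "- f" "- L"] tendsto_minus[OF L] by (simp add: blinfun.minus_left)
    show "y \<in> closure ?D"
    proof (rule ccontr)
      assume "y \<notin> closure ?D"
      then obtain f :: "'b \<Rightarrow>\<^sub>L real"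
        where f: "\<And>z. z \<in> closure ?D \<Longrightarrow> blinfun_apply f z = 0" "blinfun_apply f y \<noteq> 0"
        using closed_subspace_separation[OF closure_rational_combinations(1)[of X] closed_closure]
        by blast
      have "x n \<in> closure ?D" for n
        using closure_rational_combinations(2)[of X "s n"] closure_subset[of ?D]
        by (auto simp: x_def)
      then have "blinfun_apply f y = 0" by (intro eq) (simp add: f(1))
      with f(2) show False ..
    qed
    show "(\<lambda>n. blinfun_apply (F d) (x n)) \<longlonglongrightarrow> blinfun_apply (F d) y" if d: "d \<in> ?D" for d
    proof -
      obtain L where "(\<lambda>n. blinfun_apply (F d) (x n)) \<longlonglongrightarrow> L"
        using conv[OF d] by (auto simp: convergent_def)
      with eq[OF this] show ?thesis by simp
    qed
  qed
  have unique: "y = z"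
    if y: "\<And>f. blinfun_apply f y \<le> upper_limit (\<lambda>n. blinfun_apply f (x n))"
    and z: "\<And>f. blinfun_apply f z \<le> upper_limit (\<lambda>n. blinfun_apply f (x n))" for y z
  proof -
    have "y - z = 0"
    proof (rule norming_functionals_total[OF F])
      show "y - z \<in> closure ?D"
        using determined[OF y] determined[OF z] closure_rational_combinations(1)[of X]
        by (blast intro: subspace_diff)
      show "blinfun_apply (F d) (y - z) = 0" if "d \<in> ?D" for d
        using determined[OF y] determined[OF z] that LIMSEQ_unique
        by (fastforce simp: blinfun.diff_right)
    qed
    then show ?thesis by simp
  qed
  obtain y where y: "\<And>f. blinfun_apply f y \<le> upper_limit (\<lambda>n. blinfun_apply f (x n))"
    by (rule exists_point_attaining_upper_limit[where X = x, OF refl xb]) (rule that)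
  have attained: "blinfun_apply f y = upper_limit (\<lambda>n. blinfun_apply f (x n))" for f
  proof -
    obtain z where z: "\<And>f. blinfun_apply f z \<le> upper_limit (\<lambda>n. blinfun_apply f (x n))"
      "blinfun_apply f z = upper_limit (\<lambda>n. blinfun_apply f (x n))"
      by (rule exists_point_attaining_upper_limit[where X = x and g = f, OF refl xb]) (rule that)
    with unique[OF y z(1)] show ?thesis by simp
  qed
  have "(\<lambda>n. blinfun_apply f (x n)) \<longlonglongrightarrow> blinfun_apply f y" for f :: "'b \<Rightarrow>\<^sub>L real"
  proof (rule LIMSEQ_I)
    fix e :: real assume e: "e > 0"
    have "\<forall>\<^sub>F n in sequentially. norm (blinfun_apply f (x n) - blinfun_apply f y) < e"
      using upper_limit[OF attained[of f] half_gt_zero[OF e]]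
        upper_limit[OF attained[of "- f"] half_gt_zero[OF e]]
      by eventually_elim (use e in \<open>simp add: blinfun.minus_left abs_less_iff\<close>)
    then show "\<exists>N. \<forall>n\<ge>N. norm (blinfun_apply f (x n) - blinfun_apply f y) < e"
      by (simp add: eventually_sequentially)
  qed
  then have "weakly_converges (X \<circ> s) y" by (simp add: weakly_converges_def x_def)
  with s(1) show thesis by (rule that)
qed

section \<open>The multiplier whose minimizer lies on a given level of the constraint\<close>

lemma seq_weakly_lsc_eventually:
  assumes "seq_weakly_lsc P" and "weakly_converges X x" and "e > 0"
  shows "\<forall>\<^sub>F n in sequentially. P x - e < P (X n)"
proof -
  have "ereal (P x - e) < ereal (P x)" using assms(3) by simp
  also have "\<dots> \<le> liminf (\<lambda>n. ereal (P (X n)))"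
    using assms(1,2) unfolding seq_weakly_lsc_def by blast
  finally have "\<forall>\<^sub>F n in sequentially. ereal (P x - e) < ereal (P (X n))"
    by (rule less_LiminfD)
  then show ?thesis by simp
qed

text \<open>The part of the hypotheses that does not involve the measure space.\<close>
locale scalarized_minimization =
  fixes \<phi> \<psi> :: "'b::real_normed_vector \<Rightarrow> real" and a b :: ereal
  assumes reflexive: "reflexive_space TYPE('b)"
    and lsc_\<phi>: "seq_weakly_lsc \<phi>" and lsc_\<psi>: "seq_weakly_lsc \<psi>"
    and a_nonneg: "0 \<le> a" and a_less_b: "a < b"
    and coercive: "\<And>l. a < ereal l \<Longrightarrow> ereal l < b \<Longrightarrow> coercive (\<lambda>y. \<phi> y + l * \<psi> y)"
    and unique_minimum: "\<And>l. a < ereal l \<Longrightarrow> ereal l < b \<Longrightarrow>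
           \<exists>!y. y \<in> global_minima (\<lambda>y. \<phi> y + l * \<psi> y)"
begin

definition multipliers :: "real set" where
  "multipliers = {l. a < ereal l \<and> ereal l < b}"

definition minimizer :: "real \<Rightarrow> 'b" where
  "minimizer l = (THE y. y \<in> global_minima (\<lambda>y. \<phi> y + l * \<psi> y))"

lemma multipliers_pos: "l \<in> multipliers \<Longrightarrow> l > 0"
  using a_nonneg unfolding multipliers_def by (auto dest: le_less_trans)

lemma multipliers_between: "k \<in> multipliers \<Longrightarrow> m \<in> multipliers \<Longrightarrow> k \<le> l \<Longrightarrow> l \<le> m \<Longrightarrow> l \<in> multipliers"
  using less_le_trans[of a "ereal k" "ereal l"] le_less_trans[of "ereal l" "ereal m" b]
  unfolding multipliers_def by simp

lemma multipliers_nonempty: "\<exists>l. l \<in> multipliers"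
  using ereal_dense2[OF a_less_b] unfolding multipliers_def by auto

lemma multipliers_open:
  assumes "l \<in> multipliers"
  shows "\<exists>c\<in>multipliers. c < l" and "\<exists>d\<in>multipliers. l < d"
proof -
  obtain c where "a < ereal c" "ereal c < ereal l"
    using assms ereal_dense2[of a "ereal l"] unfolding multipliers_def by auto
  then show "\<exists>c\<in>multipliers. c < l"
    using assms less_trans[of "ereal c" "ereal l" b] unfolding multipliers_def by auto
  obtain d where "ereal l < ereal d" "ereal d < b"
    using assms ereal_dense2[of "ereal l" b] unfolding multipliers_def by auto
  then show "\<exists>d\<in>multipliers. l < d"
    using assms less_trans[of a "ereal l" "ereal d"] unfolding multipliers_def by auto
qed

lemma connected_multipliers: "connected multipliers"
  unfolding is_interval_connected_1[symmetric] is_interval_1 using multipliers_between by blast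

lemma minimizer_global_minimum:
  "l \<in> multipliers \<Longrightarrow> minimizer l \<in> global_minima (\<lambda>y. \<phi> y + l * \<psi> y)"
  unfolding minimizer_def multipliers_def by (rule theI') (use unique_minimum in auto)

lemma minimizer_le:
  "l \<in> multipliers \<Longrightarrow> \<phi> (minimizer l) + l * \<psi> (minimizer l) \<le> \<phi> z + l * \<psi> z"
  using minimizer_global_minimum unfolding global_minima_def by auto

lemma eq_minimizer:
  "l \<in> multipliers \<Longrightarrow> y \<in> global_minima (\<lambda>y. \<phi> y + l * \<psi> y) \<Longrightarrow> y = minimizer l"
  using unique_minimum[of l] minimizer_global_minimum[of l] unfolding multipliers_def by auto

lemma minimizer_antimono:
  assumes "k \<in> multipliers" and "l \<in> multipliers" and "k \<le> l"
  shows "\<psi> (minimizer l) \<le> \<psi> (minimizer k)"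
proof (cases "k = l")
  case False
  have "(l - k) * (\<psi> (minimizer l) - \<psi> (minimizer k)) \<le> 0"
    using minimizer_le[OF assms(1), of "minimizer l"] minimizer_le[OF assms(2), of "minimizer k"]
    by (simp add: algebra_simps)
  with False assms(3) show ?thesis by (simp add: mult_le_0_iff)
qed simp

text \<open>The compactness step.  Boundedness of \<open>\<psi>\<close> along the minimizers lets one change the multiplier in
\<open>\<phi> + l n \<psi>\<close> to a fixed one at bounded cost, so coercivity for a single multiplier bounds the
minimizers, and to the limit \<open>L\<close> at vanishing cost, so weak limits minimize \<open>\<phi> + L \<psi>\<close>.  The limit
\<open>L\<close> may be an end point of the interval.  If \<open>L > 0\<close>, both summands are lower semicontinuous while
their sum converges to its value at the weak limit, so each summand converges.\<close>
lemma limit_of_minimizers: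
  assumes l: "\<And>n. l n \<in> multipliers" "l \<longlonglongrightarrow> L" "L \<ge> 0"
    and bdd: "\<And>n. \<bar>\<psi> (minimizer (l n))\<bar> \<le> C"
  obtains s y where "strict_mono s" and "y \<in> global_minima (\<lambda>y. \<phi> y + L * \<psi> y)"
    and "\<And>e. e > 0 \<Longrightarrow> \<forall>\<^sub>F n in sequentially. \<psi> y - e < \<psi> (minimizer (l (s n)))"
    and "L > 0 \<Longrightarrow> (\<lambda>n. \<psi> (minimizer (l (s n)))) \<longlonglongrightarrow> \<psi> y"
proof -
  define x where "x = (\<lambda>n. minimizer (l n))"
  obtain B where B: "\<And>n. \<bar>l n\<bar> \<le> B"
    using convergent_imp_bounded[OF l(2)] unfolding bounded_iff by auto
  have shift: "\<phi> (x n) + k * \<psi> (x n) \<le> \<phi> z + l n * \<psi> z + \<bar>k - l n\<bar> * C" for k n z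
  proof -
    have "(k - l n) * \<psi> (x n) \<le> \<bar>k - l n\<bar> * \<bar>\<psi> (x n)\<bar>"
      by (metis abs_ge_self abs_mult)
    also have "\<dots> \<le> \<bar>k - l n\<bar> * C"
      using bdd by (intro mult_left_mono) (auto simp: x_def)
    finally have "(k - l n) * \<psi> (x n) \<le> \<bar>k - l n\<bar> * C" .
    with minimizer_le[OF l(1), of n z] show ?thesis by (simp add: x_def algebra_simps)
  qed
  obtain k where k: "k \<in> multipliers" using multipliers_nonempty by blast
  have C: "C \<ge> 0" using bdd[of 0] by simp
  define E where "E = \<phi> 0 + B * \<bar>\<psi> 0\<bar> + (\<bar>k\<bar> + B) * C"
  have E: "\<phi> (x n) + k * \<psi> (x n) \<le> E" for n
  proof -
    have "l n * \<psi> 0 \<le> \<bar>l n\<bar> * \<bar>\<psi> 0\<bar>" by (metis abs_ge_self abs_mult)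
    also have "\<dots> \<le> B * \<bar>\<psi> 0\<bar>" by (intro mult_right_mono B) simp
    finally have "l n * \<psi> 0 \<le> B * \<bar>\<psi> 0\<bar>" .
    moreover have "\<bar>k - l n\<bar> * C \<le> (\<bar>k\<bar> + B) * C"
      using B[of n] C by (intro mult_right_mono) auto
    ultimately show ?thesis using shift[of n k 0] by (simp add: E_def)
  qed
  have "filterlim (\<lambda>y. \<phi> y + k * \<psi> y) at_top at_infinity"
    using coercive[of k] k unfolding multipliers_def coercive_def by simp
  then obtain R where R: "\<And>y. norm y \<ge> R \<Longrightarrow> E + 1 \<le> \<phi> y + k * \<psi> y"
    unfolding filterlim_at_top eventually_at_infinity by blast
  have "norm (x n) \<le> R" for n
    using R[of "x n"] E[of n] by (cases "R \<le> norm (x n)") auto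
  then obtain s y where s: "strict_mono s" and y: "weakly_converges (x \<circ> s) y"
    using reflexive_bounded_imp_weakly_convergent_subsequence[OF reflexive] by blast
  note lower_\<phi> = seq_weakly_lsc_eventually[OF lsc_\<phi> y]
    and lower_\<psi> = seq_weakly_lsc_eventually[OF lsc_\<psi> y]
  have upper: "\<forall>\<^sub>F n in sequentially.
      \<phi> (x (s n)) + L * \<psi> (x (s n)) < \<phi> z + L * \<psi> z + e" if "e > 0" for z e
  proof -
    have "(\<lambda>n. l (s n)) \<longlonglongrightarrow> L"
      using LIMSEQ_subseq_LIMSEQ[OF l(2) s] by (simp add: o_def)
    then have "(\<lambda>n. \<phi> z + l (s n) * \<psi> z + \<bar>L - l (s n)\<bar> * C) \<longlonglongrightarrow> \<phi> z + L * \<psi> z + \<bar>L - L\<bar> * C"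
      by (intro tendsto_intros)
    then have "\<forall>\<^sub>F n in sequentially.
        \<phi> z + l (s n) * \<psi> z + \<bar>L - l (s n)\<bar> * C < \<phi> z + L * \<psi> z + e"
      by (rule order_tendstoD(2)) (use that in simp)
    then show ?thesis
      by (rule eventually_mono) (rule le_less_trans[OF shift])
  qed
  have minimum: "\<phi> y + L * \<psi> y \<le> \<phi> z + L * \<psi> z" for z
  proof (rule field_le_epsilon)
    fix e :: real assume e: "e > 0"
    define d where "d = e / (2 + L)"
    have d: "d > 0" "d * (2 + L) = e" using e l(3) by (simp_all add: d_def)
    have "\<forall>\<^sub>F n in sequentially. \<phi> y + L * \<psi> y \<le> \<phi> z + L * \<psi> z + e"
      using lower_\<phi>[OF d(1)] lower_\<psi>[OF d(1)] upper[OF d(1), of z]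
    proof eventually_elim
      case (elim n)
      have "L * (\<psi> y - d) \<le> L * \<psi> (x (s n))"
        using elim(2) l(3) by (intro mult_left_mono) auto
      with elim(1,3) d(2) show ?case by (simp add: algebra_simps)
    qed
    then show "\<phi> y + L * \<psi> y \<le> \<phi> z + L * \<psi> z + e" by simp
  qed
  have "(\<lambda>n. \<psi> (x (s n))) \<longlonglongrightarrow> \<psi> y" if L: "L > 0"
  proof (rule LIMSEQ_I)
    fix e :: real assume e: "e > 0"
    define d where "d = L * e / 2"
    have d: "d > 0" "2 * d = L * e" using e L by (simp_all add: d_def)
    have "\<forall>\<^sub>F n in sequentially. norm (\<psi> (x (s n)) - \<psi> y) < e"
      using lower_\<phi>[OF d(1)] lower_\<psi>[OF e] upper[OF d(1), of y]
    proof eventually_elim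
      case (elim n)
      have "L * \<psi> (x (s n)) < L * (\<psi> y + e)"
        using elim(1,3) d(2) by (simp add: algebra_simps)
      then have "\<psi> (x (s n)) < \<psi> y + e" using L by simp
      with elim(2) show ?case by (simp add: abs_less_iff)
    qed
    then show "\<exists>N. \<forall>n\<ge>N. norm (\<psi> (x (s n)) - \<psi> y) < e"
      by (simp add: eventually_sequentially)
  qed
  with s minimum lower_\<psi> show thesis
    by (intro that[of s y]) (auto simp: global_minima_def x_def)
qed

lemma minimizer_subsequence_continuous:
  assumes l: "\<And>n. l n \<in> multipliers" "l \<longlonglongrightarrow> L" and L: "L \<in> multipliers"
  obtains s where "(\<lambda>n. \<psi> (minimizer (l (s n)))) \<longlonglongrightarrow> \<psi> (minimizer L)"
proof -
  obtain c d where cd: "c \<in> multipliers" "c < L" "d \<in> multipliers" "L < d" using multipliers_open[OF L] by auto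
  have "\<forall>\<^sub>F n in sequentially. c < l n \<and> l n < d"
    using order_tendstoD[OF l(2)] cd by (intro eventually_conj) auto
  then obtain N where N: "\<And>n. n \<ge> N \<Longrightarrow> c < l n \<and> l n < d"
    by (auto simp: eventually_sequentially)
  have bdd: "\<bar>\<psi> (minimizer (l (n + N)))\<bar> \<le> \<bar>\<psi> (minimizer c)\<bar> + \<bar>\<psi> (minimizer d)\<bar>" for n
    using minimizer_antimono[OF cd(1) l(1), of "n + N"] minimizer_antimono[OF l(1) cd(3), of "n + N"]
      N[of "n + N"] by auto
  obtain s y where "y \<in> global_minima (\<lambda>y. \<phi> y + L * \<psi> y)"
    and "L > 0 \<Longrightarrow> (\<lambda>n. \<psi> (minimizer (l (s n + N)))) \<longlonglongrightarrow> \<psi> y"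
    by (rule limit_of_minimizers[OF l(1) LIMSEQ_ignore_initial_segment[OF l(2)]
          less_imp_le[OF multipliers_pos[OF L]] bdd]) (rule that)
  with eq_minimizer[OF L] multipliers_pos[OF L] show thesis by (intro that[of "\<lambda>n. s n + N"]) simp
qed

text \<open>Otherwise \<open>\<psi> > r\<close> at all minimizers.  If \<open>b\<close> is infinite, comparing the minimizers with a point \<open>z\<close>
of smaller constraint value fails for a large multiplier; if \<open>b\<close> is finite, the minimizers for
multipliers increasing to \<open>b\<close> accumulate at a global minimum point for \<open>b\<close> with \<open>\<psi> \<ge> r\<close>.\<close>
lemma exists_minimizer_below:
  assumes z: "\<psi> z < r" and b: "\<And>y. b \<noteq> \<infinity> \<Longrightarrow>
      y \<in> global_minima (\<lambda>y. \<phi> y + real_of_ereal b * \<psi> y) \<Longrightarrow> \<psi> y < r"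
  shows "\<exists>l\<in>multipliers. \<psi> (minimizer l) \<le> r"
proof (rule ccontr)
  assume "\<not> ?thesis"
  then have above: "r < \<psi> (minimizer l)" if "l \<in> multipliers" for l using that by force
  obtain k where k: "k \<in> multipliers" using multipliers_nonempty by blast
  show False
  proof (cases b)
    case PInf
    \<comment> \<open>from this multiplier on, the comparison with \<open>z\<close> contradicts minimality\<close>
    define l where "l = max k ((\<phi> z - \<phi> (minimizer k)) / (r - \<psi> z))"
    have l: "l \<in> multipliers" "k \<le> l"
      using k PInf unfolding multipliers_def by (auto simp: l_def less_max_iff_disj)
    have "\<phi> (minimizer k) \<le> \<phi> (minimizer l)"
      using minimizer_le[OF k, of "minimizer l"]
        mult_left_mono[OF minimizer_antimono[OF k l] less_imp_le[OF multipliers_pos[OF k]]] by simp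
    moreover have "l * r < l * \<psi> (minimizer l)" using above[OF l(1)] multipliers_pos[OF l(1)] by simp
    ultimately have "l * (r - \<psi> z) < \<phi> z - \<phi> (minimizer k)"
      using minimizer_le[OF l(1), of z] by (simp add: algebra_simps)
    then have "l < (\<phi> z - \<phi> (minimizer k)) / (r - \<psi> z)" using z by (simp add: field_simps)
    then show False by (simp add: l_def)
  next
    case (real b')
    have kb: "k < b'" "0 < b'" using conjunct2[OF k[unfolded multipliers_def mem_Collect_eq]] multipliers_pos[OF k] by (simp_all add: real)
    define l where "l = (\<lambda>n. b' - (b' - k) / real (Suc n))"
    have kl: "k \<le> l n" and l: "l n \<in> multipliers" for n
    proof -
      have "(b' - k) / real (Suc n) \<le> b' - k" "(b' - k) / real (Suc n) > 0"
        using kb by (simp_all add: field_simps mult_right_mono)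
      then have "k \<le> l n" "l n < b'" by (auto simp: l_def)
      then show "k \<le> l n" "l n \<in> multipliers"
        using k real less_le_trans[of a "ereal k" "ereal (l n)"] unfolding multipliers_def by auto
    qed
    have "(\<lambda>n. b' - (b' - k) * (1 / real (Suc n))) \<longlonglongrightarrow> b' - (b' - k) * 0"
      by (intro tendsto_intros LIMSEQ_Suc lim_1_over_n)
    then have lim: "l \<longlonglongrightarrow> b'" by (simp add: l_def)
    have bdd: "\<bar>\<psi> (minimizer (l n))\<bar> \<le> \<bar>r\<bar> + \<bar>\<psi> (minimizer k)\<bar>" for n
      using above[OF l, of n] minimizer_antimono[OF k l kl, of n] by auto
    obtain s y where y: "y \<in> global_minima (\<lambda>y. \<phi> y + b' * \<psi> y)"
      and lim_y: "0 < b' \<Longrightarrow> (\<lambda>n. \<psi> (minimizer (l (s n)))) \<longlonglongrightarrow> \<psi> y"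
      by (rule limit_of_minimizers[OF l lim less_imp_le[OF kb(2)] bdd]) (rule that)
    have "r \<le> \<psi> y"
      by (rule LIMSEQ_le_const[OF lim_y[OF kb(2)]]) (use above[OF l] in \<open>auto intro: less_imp_le\<close>)
    with b[of y] y show False by (simp add: real)
  next
    case MInf
    then show False using a_less_b by simp
  qed
qed

text \<open>The counterpart at the left end point.  Since \<open>a = 0\<close> is possible, only the lower semicontinuity
of \<open>\<psi>\<close> along the minimizers is available there, and it is the inequality needed.\<close>
lemma exists_minimizer_above:
  assumes a: "\<And>y. y \<in> global_minima (\<lambda>y. \<phi> y + real_of_ereal a * \<psi> y) \<Longrightarrow> r < \<psi> y"
  shows "\<exists>l\<in>multipliers. r \<le> \<psi> (minimizer l)"
proof (rule ccontr)
  assume "\<not> ?thesis"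
  then have below: "\<psi> (minimizer l) < r" if "l \<in> multipliers" for l using that by force
  obtain k where k: "k \<in> multipliers" using multipliers_nonempty by blast
  obtain a' where a': "a = ereal a'" using a_nonneg a_less_b by (cases a) auto
  have ka: "a' < k" "0 \<le> a'" using conjunct1[OF k[unfolded multipliers_def mem_Collect_eq]] a_nonneg by (simp_all add: a')
  define l where "l = (\<lambda>n. a' + (k - a') / real (Suc n))"
  have lk: "l n \<le> k" and l: "l n \<in> multipliers" for n
  proof -
    have "(k - a') / real (Suc n) \<le> k - a'" "(k - a') / real (Suc n) > 0"
      using ka by (simp_all add: field_simps mult_right_mono)
    then have "l n \<le> k" "a' < l n" by (auto simp: l_def)
    then show "l n \<le> k" "l n \<in> multipliers"
      using k a' le_less_trans[of "ereal (l n)" "ereal k" b] unfolding multipliers_def by auto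
  qed
  have "(\<lambda>n. a' + (k - a') * (1 / real (Suc n))) \<longlonglongrightarrow> a' + (k - a') * 0"
    by (intro tendsto_intros LIMSEQ_Suc lim_1_over_n)
  then have lim: "l \<longlonglongrightarrow> a'" by (simp add: l_def)
  have bdd: "\<bar>\<psi> (minimizer (l n))\<bar> \<le> \<bar>r\<bar> + \<bar>\<psi> (minimizer k)\<bar>" for n
    using below[OF l, of n] minimizer_antimono[OF l k lk, of n] by auto
  obtain s y where y: "y \<in> global_minima (\<lambda>y. \<phi> y + a' * \<psi> y)"
    "\<And>e. e > 0 \<Longrightarrow> \<forall>\<^sub>F n in sequentially. \<psi> y - e < \<psi> (minimizer (l (s n)))"
    by (rule limit_of_minimizers[OF l lim ka(2) bdd]) (rule that)
  have "r < \<psi> y" using a y(1) by (simp add: a')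
  then have "\<forall>\<^sub>F n in sequentially. r < \<psi> (minimizer (l (s n)))"
    using y(2)[of "\<psi> y - r"] by simp
  then obtain n where "r < \<psi> (minimizer (l (s n)))"
    using eventually_happens by fastforce
  with below[OF l, of "s n"] show False by simp
qed

text \<open>An intermediate value argument for \<open>l \<mapsto> \<psi> (minimizer l)\<close>: the two sets of multipliers where this
function is at least and at most \<open>r\<close> are nonempty and relatively closed in an interval, so they
meet.\<close>
lemma exists_multiplier:
  assumes z: "\<psi> z < r"
    and b: "\<And>y. b \<noteq> \<infinity> \<Longrightarrow>
      y \<in> global_minima (\<lambda>y. \<phi> y + real_of_ereal b * \<psi> y) \<Longrightarrow> \<psi> y < r"
    and a: "\<And>y. y \<in> global_minima (\<lambda>y. \<phi> y + real_of_ereal a * \<psi> y) \<Longrightarrow> r < \<psi> y"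
  shows "\<exists>l\<in>multipliers. \<psi> (minimizer l) = r"
proof (rule ccontr)
  assume no: "\<not> ?thesis"
  define S where "S = {l \<in> multipliers. r \<le> \<psi> (minimizer l)}"
  define T where "T = {l \<in> multipliers. \<psi> (minimizer l) \<le> r}"
  have closed: "closedin (top_of_set multipliers) A"
    if sub: "A \<subseteq> multipliers" and lim: "\<And>l L. (\<And>n. l n \<in> A) \<Longrightarrow> L \<in> multipliers \<Longrightarrow> l \<longlonglongrightarrow> L \<Longrightarrow> L \<in> A" for A
  proof -
    have "multipliers \<inter> closure A \<subseteq> A"
    proof
      fix L assume L: "L \<in> multipliers \<inter> closure A"
      then obtain l where "\<And>n. l n \<in> A" "l \<longlonglongrightarrow> L"
        by (auto simp: closure_sequential)
      with lim[of l L] L show "L \<in> A" by simp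
    qed
    then have "A = multipliers \<inter> closure A" using sub closure_subset[of A] by blast
    then show ?thesis using closedin_closed_Int[OF closed_closure, of multipliers A] by simp
  qed
  have "closedin (top_of_set multipliers) S"
  proof (rule closed)
    fix l L assume *: "\<And>n. l n \<in> S" "L \<in> multipliers" "l \<longlonglongrightarrow> L"
    then have "\<And>n. l n \<in> multipliers" by (simp add: S_def)
    then obtain s where "(\<lambda>n. \<psi> (minimizer (l (s n)))) \<longlonglongrightarrow> \<psi> (minimizer L)"
      by (rule minimizer_subsequence_continuous[OF _ *(3,2)])
    then have "r \<le> \<psi> (minimizer L)"
      by (rule LIMSEQ_le_const) (use *(1) in \<open>auto simp: S_def\<close>)
    with * show "L \<in> S" by (simp add: S_def)
  qed (auto simp: S_def)
  moreover have "closedin (top_of_set multipliers) T"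
  proof (rule closed)
    fix l L assume *: "\<And>n. l n \<in> T" "L \<in> multipliers" "l \<longlonglongrightarrow> L"
    then have "\<And>n. l n \<in> multipliers" by (simp add: T_def)
    then obtain s where "(\<lambda>n. \<psi> (minimizer (l (s n)))) \<longlonglongrightarrow> \<psi> (minimizer L)"
      by (rule minimizer_subsequence_continuous[OF _ *(3,2)])
    then have "\<psi> (minimizer L) \<le> r"
      by (rule LIMSEQ_le_const2) (use *(1) in \<open>auto simp: T_def\<close>)
    with * show "L \<in> T" by (simp add: T_def)
  qed (auto simp: T_def)
  moreover have "S \<noteq> {}" "T \<noteq> {}"
    using exists_minimizer_above[OF a] exists_minimizer_below[OF z b] by (auto simp: S_def T_def)
  moreover have "S \<inter> T = {}" "S \<union> T = multipliers"
    using no by (auto simp: S_def T_def)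
  ultimately have "\<not> connected multipliers"
    unfolding connected_closedin_eq not_not by (intro exI[of _ S] exI[of _ T] conjI)
  with connected_multipliers show False by contradiction
qed

end

section \<open>From pointwise inequalities to integral functionals\<close>

lemma LIMSEQ_imp_weakly_converges: "X \<longlonglongrightarrow> x \<Longrightarrow> weakly_converges X x"
  unfolding weakly_converges_def by (auto intro!: tendsto_intros)

lemma seq_weakly_lsc_borel_measurable:
  assumes P: "seq_weakly_lsc P"
  shows "P \<in> borel_measurable borel"
proof -
  have "closed {y. P y \<le> c}" for c
    unfolding closed_sequential_limits
  proof (intro allI impI)
    fix X y assume X: "(\<forall>n. X n \<in> {y. P y \<le> c}) \<and> X \<longlonglongrightarrow> y"
    have "P y \<le> c"
    proof (rule field_le_epsilon)
      fix e :: real assume e: "e > 0"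
      have "\<forall>\<^sub>F n in sequentially. P y - e < P (X n)"
        using X by (intro seq_weakly_lsc_eventually[OF P _ e] LIMSEQ_imp_weakly_converges) simp
      then obtain n where "P y - e < P (X n)" using eventually_happens by fastforce
      moreover have "P (X n) \<le> c" using X by simp
      ultimately show "P y \<le> c + e" by simp
    qed
    then show "y \<in> {y. P y \<le> c}" by simp
  qed
  then show ?thesis
    unfolding borel_measurable_iff_le by (simp add: borel_closed)
qed

lemma strongly_measurable_AE_eq_borel_measurable:
  assumes "strongly_measurable M u"
  obtains v where "v \<in> borel_measurable M" and "AE t in M. u t = v t"
proof -
  obtain s where s: "\<And>n::nat. simple_function M (s n)" and conv: "AE t in M. (\<lambda>n. s n t) \<longlonglongrightarrow> u t"
    using assms unfolding strongly_measurable_def by blast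
  from conv obtain N where N: "{t \<in> space M. \<not> (\<lambda>n. s n t) \<longlonglongrightarrow> u t} \<subseteq> N" "emeasure M N = 0" "N \<in> sets M"
    by (rule AE_E)
  define v where "v = (\<lambda>t. if t \<in> N then 0 else u t)"
  have "v \<in> borel_measurable M"
  proof (rule borel_measurable_LIMSEQ_metric)
    show "(\<lambda>t. if t \<in> N then 0 else s n t) \<in> borel_measurable M" for n
      using s N(3) by (intro borel_measurable_simple_function simple_function_If_set) auto
    show "(\<lambda>n. if t \<in> N then 0 else s n t) \<longlonglongrightarrow> v t" if "t \<in> space M" for t
      using N(1) that by (auto simp: v_def)
  qed
  moreover have "AE t in M. u t = v t"
    by (rule AE_I'[of N]) (use N(2,3) in \<open>auto simp: null_sets_def v_def\<close>)
  ultimately show thesis by (rule that)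
qed

lemma extended_integral_cong_AE:
  assumes "AE t in M. f t = g t"
  shows "extended_integral M f = extended_integral M g"
proof -
  have "(\<integral>\<^sup>+t. ennreal (f t) \<partial>M) = (\<integral>\<^sup>+t. ennreal (g t) \<partial>M)"
    "(\<integral>\<^sup>+t. ennreal (- f t) \<partial>M) = (\<integral>\<^sup>+t. ennreal (- g t) \<partial>M)"
    using assms by (auto intro!: nn_integral_cong_AE)
  then show ?thesis by (simp add: extended_integral_def)
qed

lemma extended_integral_eq_integral:
  assumes "integrable M f"
  shows "extended_integral M f = ereal (\<integral>t. f t \<partial>M)"
proof -
  have "(\<integral>\<^sup>+t. ennreal (f t) \<partial>M) \<noteq> \<infinity>" "(\<integral>\<^sup>+t. ennreal (- f t) \<partial>M) \<noteq> \<infinity>"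
    using assms by (auto simp: real_integrable_def)
  then show ?thesis
    using real_lebesgue_integral_def[OF assms]
    by (cases "\<integral>\<^sup>+t. ennreal (f t) \<partial>M"; cases "\<integral>\<^sup>+t. ennreal (- f t) \<partial>M")
      (auto simp: extended_integral_def enn2real_ennreal)
qed

text \<open>With an integrable minorant the extended integral is an ordinary one or \<open>\<infinity>\<close>, so the form
\<open>\<infinity> - \<infinity>\<close> does not occur.\<close>
lemma extended_integral_finite_or_infinity:
  assumes f: "f \<in> borel_measurable M" and g: "integrable M g" and le: "AE t in M. g t \<le> f t"
  shows "integrable M f \<or> extended_integral M f = \<infinity>"
proof -
  have "(\<integral>\<^sup>+t. ennreal (- f t) \<partial>M) \<le> (\<integral>\<^sup>+t. ennreal (- g t) \<partial>M)"
    using le by (intro nn_integral_mono_AE) (auto elim!: eventually_mono intro!: ennreal_leI)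
  also have "\<dots> < \<infinity>" using g by (simp add: real_integrable_def top.not_eq_extremum)
  finally have neg: "(\<integral>\<^sup>+t. ennreal (- f t) \<partial>M) < \<infinity>" .
  show ?thesis
  proof (cases "(\<integral>\<^sup>+t. ennreal (f t) \<partial>M) = \<infinity>")
    case True
    with neg show ?thesis by (auto simp: extended_integral_def)
  next
    case False
    with f neg show ?thesis by (auto simp: real_integrable_def)
  qed
qed

text \<open>The growth condition gives the minorant \<open>- c \<gamma> - c C \<parallel>v\<parallel>\<^sup>p\<close>; its first term is integrable because \<open>\<gamma>\<close> is,
its second because \<open>v\<close> is \<open>p\<close>-integrable and \<open>\<gamma>\<close> is bounded by \<open>C\<close>.\<close>
lemma weighted_composition_integrable_or_infinity:
  fixes v :: "'t \<Rightarrow> 'b::real_normed_vector"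
  assumes \<gamma>: "integrable M \<gamma>" "AE t in M. \<bar>\<gamma> t\<bar> \<le> C" "AE t in M. 0 \<le> \<gamma> t"
    and v: "v \<in> borel_measurable M" "(\<integral>\<^sup>+t. ennreal (norm (v t) powr p) \<partial>M) < \<infinity>"
    and P: "P \<in> borel_measurable borel" and c: "c \<ge> 0"
    and growth: "\<And>y. - c * (1 + norm y powr p) \<le> P y"
  shows "integrable M (\<lambda>t. \<gamma> t * P (v t)) \<or> extended_integral M (\<lambda>t. \<gamma> t * P (v t)) = \<infinity>"
proof (rule extended_integral_finite_or_infinity)
  have [measurable]: "\<gamma> \<in> borel_measurable M" using \<gamma>(1) by simp
  note [measurable] = v(1)
  have [measurable]: "(\<lambda>t. P (v t)) \<in> borel_measurable M"
    using measurable_compose[OF v(1) P] .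
  show "(\<lambda>t. \<gamma> t * P (v t)) \<in> borel_measurable M" by measurable
  have "integrable M (\<lambda>t. norm (v t) powr p)"
    using v(2) by (intro integrableI_nonneg) auto
  then show "integrable M (\<lambda>t. - c * \<gamma> t - c * C * norm (v t) powr p)"
    using \<gamma>(1) by (intro Bochner_Integration.integrable_diff integrable_mult_right)
  show "AE t in M. - c * \<gamma> t - c * C * norm (v t) powr p \<le> \<gamma> t * P (v t)"
    using \<gamma>(2,3)
  proof eventually_elim
    case (elim t)
    have "c * (\<gamma> t * norm (v t) powr p) \<le> c * (C * norm (v t) powr p)"
      using elim c by (intro mult_left_mono mult_right_mono) auto
    moreover have "\<gamma> t * (- c * (1 + norm (v t) powr p)) \<le> \<gamma> t * P (v t)"
      using elim by (intro mult_left_mono growth) auto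
    ultimately show ?case by (simp add: algebra_simps)
  qed
qed

text \<open>Weak duality: integrating \<open>m + l r \<le> \<phi> + l \<psi>\<close> along \<open>u\<close> and using the constraint with \<open>l \<ge> 0\<close> removes
the terms with \<open>l\<close>.\<close>
lemma multiplier_lower_bound:
  fixes u :: "'t \<Rightarrow> 'b::real_normed_vector"
  assumes u: "u \<in> Lp_space p M"
    and \<gamma>: "integrable M \<gamma>" "AE t in M. \<bar>\<gamma> t\<bar> \<le> C" "AE t in M. 0 \<le> \<gamma> t"
    and meas: "\<phi> \<in> borel_measurable borel" "\<psi> \<in> borel_measurable borel"
    and growth: "c \<ge> 0" "\<And>y. - c * (1 + norm y powr p) \<le> \<phi> y"
      "\<And>y. - c * (1 + norm y powr p) \<le> \<psi> y"
    and multiplier: "l \<ge> 0" "\<And>y. m + l * r \<le> \<phi> y + l * \<psi> y"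
    and constraint: "extended_integral M (\<lambda>t. \<gamma> t * \<psi> (u t)) \<le> ereal (r * (\<integral>t. \<gamma> t \<partial>M))"
  shows "ereal (m * (\<integral>t. \<gamma> t \<partial>M)) \<le> extended_integral M (\<lambda>t. \<gamma> t * \<phi> (u t))"
proof -
  have "strongly_measurable M u" using u by (simp add: Lp_space_def)
  then obtain v where v: "v \<in> borel_measurable M" "AE t in M. u t = v t"
    by (rule strongly_measurable_AE_eq_borel_measurable)
  have "(\<integral>\<^sup>+t. ennreal (norm (v t) powr p) \<partial>M) = (\<integral>\<^sup>+t. ennreal (norm (u t) powr p) \<partial>M)"
    using v(2) by (intro nn_integral_cong_AE) auto
  then have fin: "(\<integral>\<^sup>+t. ennreal (norm (v t) powr p) \<partial>M) < \<infinity>"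
    using u by (simp add: Lp_space_def)
  have eq: "extended_integral M (\<lambda>t. \<gamma> t * P (u t)) = extended_integral M (\<lambda>t. \<gamma> t * P (v t))" for P
    using v(2) by (intro extended_integral_cong_AE) auto
  note dichotomy = weighted_composition_integrable_or_infinity[OF \<gamma> v(1) fin _ growth(1)]
  have int_\<psi>: "integrable M (\<lambda>t. \<gamma> t * \<psi> (v t))"
    using dichotomy[OF meas(2) growth(3)] constraint by (auto simp: eq)
  show ?thesis
  proof (cases "integrable M (\<lambda>t. \<gamma> t * \<phi> (v t))")
    case False
    with dichotomy[OF meas(1) growth(2)] show ?thesis by (simp add: eq)
  next
    case True
    have "(\<integral>t. \<gamma> t * \<psi> (v t) \<partial>M) \<le> r * (\<integral>t. \<gamma> t \<partial>M)"
      using constraint by (simp add: eq extended_integral_eq_integral[OF int_\<psi>])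
    from mult_left_mono[OF this multiplier(1)]
    have \<psi>_le: "l * (\<integral>t. \<gamma> t * \<psi> (v t) \<partial>M) \<le> l * r * (\<integral>t. \<gamma> t \<partial>M)" by simp
    have "(\<integral>t. (m + l * r) * \<gamma> t \<partial>M) \<le> (\<integral>t. \<gamma> t * \<phi> (v t) + l * (\<gamma> t * \<psi> (v t)) \<partial>M)"
    proof (rule integral_mono_AE)
      show "integrable M (\<lambda>t. (m + l * r) * \<gamma> t)" using \<gamma>(1) by simp
      show "integrable M (\<lambda>t. \<gamma> t * \<phi> (v t) + l * (\<gamma> t * \<psi> (v t)))"
        using True int_\<psi> by simp
      show "AE t in M. (m + l * r) * \<gamma> t \<le> \<gamma> t * \<phi> (v t) + l * (\<gamma> t * \<psi> (v t))"
        using \<gamma>(3)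
      proof eventually_elim
        case (elim t)
        then show ?case
          using mult_left_mono[OF multiplier(2)[of "v t"] elim] by (simp add: algebra_simps)
      qed
    qed
    then have "(m + l * r) * (\<integral>t. \<gamma> t \<partial>M)
        \<le> (\<integral>t. \<gamma> t * \<phi> (v t) \<partial>M) + l * (\<integral>t. \<gamma> t * \<psi> (v t) \<partial>M)"
      using True int_\<psi> by simp
    with \<psi>_le have "m * (\<integral>t. \<gamma> t \<partial>M) \<le> (\<integral>t. \<gamma> t * \<phi> (v t) \<partial>M)"
      by (simp add: algebra_simps)
    then show ?thesis by (simp add: eq extended_integral_eq_integral[OF True])
  qed
qed

text \<open>When the measure is infinite, a nonzero constant is not in \<open>L\<^sup>p\<close> and must be cut off outside a set
\<open>F\<close> of finite measure.  The cut-off may violate the constraint; the set \<open>A\<close> is where this is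
repaired.  It must have small weight, yet at least \<open>k\<close> times the weight of the complement of \<open>F\<close>.  As the
measure may have atoms, \<open>A\<close> cannot be taken of arbitrary small weight inside a given set; it is
taken as \<open>T n - T N\<close> for an exhaustion \<open>T\<close>, with \<open>N\<close> large and then \<open>n\<close> much larger.\<close>
lemma exists_small_set_dominating_tail:
  fixes \<gamma> :: "'t \<Rightarrow> real"
  assumes M: "sigma_finite_measure M" and \<gamma>: "integrable M \<gamma>" "AE t in M. 0 \<le> \<gamma> t"
    and d: "d > 0" and k: "k \<ge> 0"
  obtains A F where "A \<in> sets M" and "F \<in> sets M" and "A \<subseteq> F" and "emeasure M F < \<infinity>"
    and "0 \<le> (LINT t:A|M. \<gamma> t)" and "(LINT t:A|M. \<gamma> t) \<le> d"
    and "0 \<le> (LINT t:(space M - F)|M. \<gamma> t)" and "(LINT t:(space M - F)|M. \<gamma> t) \<le> d"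
    and "k * (LINT t:(space M - F)|M. \<gamma> t) \<le> (LINT t:A|M. \<gamma> t)"
proof -
  interpret sigma_finite_measure M by fact
  obtain T :: "nat \<Rightarrow> 't set" where T: "range T \<subseteq> sets M" "(\<Union>i. T i) = space M"
    "\<And>i. emeasure M (T i) \<noteq> \<infinity>" "incseq T" by (rule sigma_finite_incseq) (rule that)
  have [measurable]: "T n \<in> sets M" for n using T(1) by auto
  have [measurable]: "\<gamma> \<in> borel_measurable M" using \<gamma>(1) by simp
  have nonneg: "0 \<le> (LINT t:B|M. \<gamma> t)" for B
    unfolding set_lebesgue_integral_def
    using \<gamma>(2) by (intro integral_nonneg_AE) (auto elim!: eventually_mono)
  define e where "e = (\<lambda>n. LINT t:(space M - T n)|M. \<gamma> t)"
  have int: "integrable M (\<lambda>t. indicator (space M - T n) t *\<^sub>R \<gamma> t)" for n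
    using \<gamma>(1) by (intro integrable_mult_indicator) auto
  have diff: "(LINT t:(T n - T N)|M. \<gamma> t) = e N - e n" if "N \<le> n" for N n
  proof -
    have "T N \<subseteq> T n" using incseqD[OF T(4) that] .
    then have "(LINT t:(T n - T N)|M. \<gamma> t)
        = (\<integral>t. indicator (space M - T N) t *\<^sub>R \<gamma> t - indicator (space M - T n) t *\<^sub>R \<gamma> t \<partial>M)"
      unfolding set_lebesgue_integral_def
      by (intro Bochner_Integration.integral_cong) (auto split: split_indicator)
    also have "\<dots> = e N - e n"
      unfolding e_def set_lebesgue_integral_def by (intro Bochner_Integration.integral_diff int)
    finally show ?thesis .
  qed
  have lim: "e \<longlonglongrightarrow> 0"
  proof -
    have "(\<lambda>n. \<integral>t. indicator (space M - T n) t *\<^sub>R \<gamma> t \<partial>M) \<longlonglongrightarrow> (\<integral>t. 0 \<partial>M)"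
    proof (rule integral_dominated_convergence[where w = "\<lambda>t. norm (\<gamma> t)"])
      show "integrable M (\<lambda>t. norm (\<gamma> t))" using \<gamma>(1) by simp
      show "AE t in M. (\<lambda>n. indicator (space M - T n) t *\<^sub>R \<gamma> t) \<longlonglongrightarrow> 0"
      proof (rule AE_I2)
        fix t assume "t \<in> space M"
        then obtain N where "t \<in> T N" using T(2) by blast
        then have "\<forall>\<^sub>F n in sequentially. indicator (space M - T n) t *\<^sub>R \<gamma> t = 0"
          using incseqD[OF T(4)] by (intro eventually_sequentiallyI[of N]) (auto split: split_indicator)
        then show "(\<lambda>n. indicator (space M - T n) t *\<^sub>R \<gamma> t) \<longlonglongrightarrow> 0"
          by (rule tendsto_eventually)
      qed
    qed (auto split: split_indicator)
    then show ?thesis by (simp add: e_def set_lebesgue_integral_def)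
  qed
  obtain N where N: "e N < d"
    using order_tendstoD(2)[OF lim d] eventually_happens by fastforce
  have e_nonneg: "0 \<le> e n" for n by (simp add: e_def nonneg)
  have "\<exists>n\<ge>N. (k + 1) * e n \<le> e N"
  proof (cases "e N = 0")
    case True
    then show ?thesis by auto
  next
    case False
    then have "e N / (k + 1) > 0" using e_nonneg[of N] k by simp
    from order_tendstoD(2)[OF lim this] eventually_ge_at_top[of N]
    have "\<forall>\<^sub>F n in sequentially. e n < e N / (k + 1) \<and> N \<le> n" by (rule eventually_conj)
    then obtain n where "e n < e N / (k + 1)" "N \<le> n" using eventually_happens by fastforce
    then show ?thesis using k by (intro exI[of _ n]) (simp add: field_simps)
  qed
  then obtain n where n: "N \<le> n" "(k + 1) * e n \<le> e N" by blast
  have "e n \<le> e N" using diff[OF n(1)] nonneg[of "T n - T N"] by simp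
  show thesis
  proof (rule that[of "T n - T N" "T n"])
    show "emeasure M (T n) < \<infinity>" using T(3)[of n] by (simp add: less_top)
    show "(LINT t:(T n - T N)|M. \<gamma> t) \<le> d" using diff[OF n(1)] N e_nonneg[of n] by simp
    show "(LINT t:(space M - T n)|M. \<gamma> t) \<le> d"
      using \<open>e n \<le> e N\<close> N by (simp add: e_def)
    show "k * (LINT t:(space M - T n)|M. \<gamma> t) \<le> (LINT t:(T n - T N)|M. \<gamma> t)"
      using n(2) diff[OF n(1)] by (simp add: e_def algebra_simps)
  qed (auto intro: nonneg)
qed

definition three_step :: "'t set \<Rightarrow> 't set \<Rightarrow> 'b \<Rightarrow> 'b::zero \<Rightarrow> 't \<Rightarrow> 'b" where
  "three_step A F y0 y1 t = (if t \<in> A then y0 else if t \<in> F then y1 else 0)"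

lemma three_step_in_Lp_space:
  fixes y0 y1 :: "'b::real_normed_vector"
  assumes [measurable]: "A \<in> sets M" "F \<in> sets M" and "A \<subseteq> F" "emeasure M F < \<infinity>"
  shows "three_step A F y0 y1 \<in> Lp_space p M"
proof -
  have "simple_function M (three_step A F y0 y1)"
    unfolding three_step_def by (intro simple_function_If_set simple_function_const) auto
  then have "strongly_measurable M (three_step A F y0 y1)"
    unfolding strongly_measurable_def by (intro exI[of _ "\<lambda>_. three_step A F y0 y1"]) auto
  moreover have "(\<integral>\<^sup>+t. ennreal (norm (three_step A F y0 y1 t) powr p) \<partial>M)
      \<le> (\<integral>\<^sup>+t. ennreal (norm y0 powr p + norm y1 powr p) * indicator F t \<partial>M)"
    using assms(3) by (intro nn_integral_mono)
      (auto simp: three_step_def subset_iff intro!: ennreal_leI split: split_indicator)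
  moreover have "\<dots> < \<infinity>"
    using assms(4) by (simp add: nn_integral_cmult_indicator ennreal_mult_less_top)
  ultimately show ?thesis by (simp add: Lp_space_def)
qed

lemma extended_integral_three_step:
  fixes \<gamma> :: "'t \<Rightarrow> real"
  assumes \<gamma>: "integrable M \<gamma>" and [measurable]: "A \<in> sets M" "F \<in> sets M" and AF: "A \<subseteq> F"
  shows "extended_integral M (\<lambda>t. \<gamma> t * P (three_step A F y0 y1 t)) =
    ereal (P y1 * (\<integral>t. \<gamma> t \<partial>M) + (P y0 - P y1) * (LINT t:A|M. \<gamma> t)
      + (P 0 - P y1) * (LINT t:(space M - F)|M. \<gamma> t))"
proof -
  define hA where "hA = (\<lambda>t. indicator A t *\<^sub>R \<gamma> t)"
  define hF where "hF = (\<lambda>t. indicator (space M - F) t *\<^sub>R \<gamma> t)"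
  have int: "integrable M hA" "integrable M hF"
    using integrable_mult_indicator[OF _ \<gamma>] by (simp_all add: hA_def hF_def)
  let ?g = "\<lambda>t. P y1 * \<gamma> t + (P y0 - P y1) * hA t + (P 0 - P y1) * hF t"
  have "AE t in M. \<gamma> t * P (three_step A F y0 y1 t) = ?g t"
    using AF by (intro AE_I2)
      (auto simp: three_step_def hA_def hF_def algebra_simps split: split_indicator)
  then have "extended_integral M (\<lambda>t. \<gamma> t * P (three_step A F y0 y1 t)) = extended_integral M ?g"
    by (rule extended_integral_cong_AE)
  also have "\<dots> = ereal (\<integral>t. ?g t \<partial>M)"
    using \<gamma> int by (intro extended_integral_eq_integral) simp
  also have "(\<integral>t. ?g t \<partial>M) =
      P y1 * (\<integral>t. \<gamma> t \<partial>M) + (P y0 - P y1) * (\<integral>t. hA t \<partial>M) + (P 0 - P y1) * (\<integral>t. hF t \<partial>M)"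
    using \<gamma> int by simp
  finally show ?thesis by (simp add: set_lebesgue_integral_def hA_def hF_def)
qed

text \<open>The competitor is \<open>y1\<close> except on a set of small weight: it vanishes off \<open>F\<close> and equals \<open>y0\<close> on \<open>A\<close>,
where the strict inequality \<open>\<psi> y0 < r\<close> gains what is lost off \<open>F\<close>.\<close>
lemma exists_near_constant_competitor:
  fixes \<phi> \<psi> :: "'b::real_normed_vector \<Rightarrow> real"
  assumes M: "sigma_finite_measure M" and \<gamma>: "integrable M \<gamma>" "AE t in M. 0 \<le> \<gamma> t"
    and y0: "\<psi> y0 < r" and y1: "\<psi> y1 = r" and e: "e > 0"
  obtains u where "u \<in> V_set M p \<psi> \<gamma> r"
    and "extended_integral M (\<lambda>t. \<gamma> t * \<phi> (u t)) \<le> ereal (\<phi> y1 * (\<integral>t. \<gamma> t \<partial>M)) + ereal e"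
proof -
  define D where "D = \<bar>\<phi> y0 - \<phi> y1\<bar> + \<bar>\<phi> 0 - \<phi> y1\<bar>"
  define d where "d = e / (1 + D)"
  have D: "D \<ge> 0" by (simp add: D_def)
  have d: "d > 0" "D * d \<le> e" using e D by (simp_all add: d_def field_simps)
  \<comment> \<open>the loss per unit of weight off \<open>F\<close> divided by the gain per unit of weight on \<open>A\<close>\<close>
  define k where "k = \<bar>\<psi> 0 - r\<bar> / (r - \<psi> y0)"
  have k: "k \<ge> 0" "(r - \<psi> y0) * k = \<bar>\<psi> 0 - r\<bar>" using y0 by (simp_all add: k_def)
  obtain A F where AF: "A \<in> sets M" "F \<in> sets M" "A \<subseteq> F" "emeasure M F < \<infinity>"
    and A: "0 \<le> (LINT t:A|M. \<gamma> t)" "(LINT t:A|M. \<gamma> t) \<le> d"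
    and F: "0 \<le> (LINT t:(space M - F)|M. \<gamma> t)" "(LINT t:(space M - F)|M. \<gamma> t) \<le> d"
    and dom: "k * (LINT t:(space M - F)|M. \<gamma> t) \<le> (LINT t:A|M. \<gamma> t)"
    by (rule exists_small_set_dominating_tail[OF M \<gamma> d(1) k(1)])
  let ?u = "three_step A F y0 y1"
  note ext = extended_integral_three_step[OF \<gamma>(1) AF(1-3), where ?y0.0 = y0 and ?y1.0 = y1]
  let ?a = "LINT t:A|M. \<gamma> t" and ?f = "LINT t:(space M - F)|M. \<gamma> t"
  have "(\<psi> 0 - r) * ?f \<le> \<bar>\<psi> 0 - r\<bar> * ?f" using F(1) by (intro mult_right_mono) auto
  also have "\<dots> = (r - \<psi> y0) * (k * ?f)" by (simp add: k(2)[symmetric])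
  also have "\<dots> \<le> (r - \<psi> y0) * ?a" using dom y0 by (intro mult_left_mono) auto
  finally have "(\<psi> y0 - r) * ?a + (\<psi> 0 - r) * ?f \<le> 0" by (simp add: algebra_simps)
  then have "?u \<in> V_set M p \<psi> \<gamma> r"
    using three_step_in_Lp_space[OF AF, where p = p] by (simp add: V_set_def ext y1)
  moreover have "extended_integral M (\<lambda>t. \<gamma> t * \<phi> (?u t)) \<le> ereal (\<phi> y1 * (\<integral>t. \<gamma> t \<partial>M)) + ereal e"
  proof -
    have "(\<phi> y0 - \<phi> y1) * ?a \<le> \<bar>\<phi> y0 - \<phi> y1\<bar> * d" "(\<phi> 0 - \<phi> y1) * ?f \<le> \<bar>\<phi> 0 - \<phi> y1\<bar> * d"
      using A F by (intro mult_mono; simp)+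
    then show ?thesis using d(2) by (simp add: ext D_def algebra_simps)
  qed
  ultimately show thesis by (rule that)
qed

lemma growth_bound:
  fixes \<phi> \<psi> :: "'b::real_normed_vector \<Rightarrow> real"
  assumes "(INF y. ereal (min (\<phi> y) (\<psi> y) / (1 + norm y powr p))) > - \<infinity>"
  obtains c where "c \<ge> 0" and "\<And>y. - c * (1 + norm y powr p) \<le> \<phi> y"
    and "\<And>y. - c * (1 + norm y powr p) \<le> \<psi> y"
proof -
  obtain k where k: "ereal k < (INF y. ereal (min (\<phi> y) (\<psi> y) / (1 + norm y powr p)))"
    using ereal_dense2[OF assms] by blast
  have "- \<bar>k\<bar> * (1 + norm y powr p) \<le> min (\<phi> y) (\<psi> y)" for y
  proof -
    have pos: "0 < 1 + norm y powr p" by (simp add: add_pos_nonneg)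
    have "ereal k < ereal (min (\<phi> y) (\<psi> y) / (1 + norm y powr p))"
      using k by (rule less_le_trans) (rule INF_lower, simp)
    then have "k \<le> min (\<phi> y) (\<psi> y) / (1 + norm y powr p)" by simp
    then have "- \<bar>k\<bar> \<le> min (\<phi> y) (\<psi> y) / (1 + norm y powr p)" by simp
    then show ?thesis using pos by (simp only: pos_le_divide_eq)
  qed
  then show thesis by (intro that[of "\<bar>k\<bar>"]) auto
qed

theorem theorem1:
  fixes M :: "'t measure"
    and p :: real
    and \<phi> \<psi> :: "'b::banach \<Rightarrow> real"
    and a b \<alpha> \<beta> :: ereal
  assumes "sigma_finite_measure M"
    and "emeasure M (space M) > 0"
    and "reflexive_space TYPE('b)"
    and "p > 0"
    and "seq_weakly_lsc \<phi>"
    and "seq_weakly_lsc \<psi>"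
    and "(INF y. ereal (min (\<phi> y) (\<psi> y) / (1 + norm y powr p))) > - \<infinity>"
    and "0 \<le> a" and "a < b"
    and "\<alpha> = max (INF y. ereal (\<psi> y)) (SUP y\<in>M_set \<phi> \<psi> b. ereal (\<psi> y))"
    and "\<beta> = min (SUP y. ereal (\<psi> y)) (INF y\<in>M_set \<phi> \<psi> a. ereal (\<psi> y))"
    and "\<And>l::real. a < ereal l \<Longrightarrow> ereal l < b \<Longrightarrow> coercive (\<lambda>y. \<phi> y + l * \<psi> y)"
    and "\<And>l::real. a < ereal l \<Longrightarrow> ereal l < b \<Longrightarrow>
           \<exists>!y. y \<in> global_minima (\<lambda>y. \<phi> y + l * \<psi> y)"
    and "\<alpha> < \<beta>"
  shows "\<forall>(\<gamma>::'t \<Rightarrow> real) (r::real).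
           integrable M \<gamma> \<and> (\<exists>C. AE t in M. \<bar>\<gamma> t\<bar> \<le> C) \<and>
           \<not> (AE t in M. \<gamma> t = 0) \<and> (AE t in M. \<gamma> t \<ge> 0) \<and>
           \<alpha> < ereal r \<and> ereal r < \<beta> \<longrightarrow>
           (INF u\<in>V_set M p \<psi> \<gamma> r. extended_integral M (\<lambda>t. \<gamma> t * \<phi> (u t)))
             = (INF y\<in>\<psi> -` {r}. ereal (\<phi> y)) * ereal (\<integral>t. \<gamma> t \<partial>M)"
proof (intro allI impI, elim conjE exE)
  fix \<gamma> :: "'t \<Rightarrow> real" and r C :: real
  assume \<gamma>: "integrable M \<gamma>" "AE t in M. \<bar>\<gamma> t\<bar> \<le> C" "AE t in M. 0 \<le> \<gamma> t"
    and r: "\<alpha> < ereal r" "ereal r < \<beta>"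
  interpret scalarized_minimization \<phi> \<psi> a b
    by unfold_locales (fact assms)+
  have "(INF y. ereal (\<psi> y)) < ereal r" using r(1) assms(10) by simp
  then obtain y0 where y0: "\<psi> y0 < r" unfolding INF_less_iff by auto
  have b: "\<psi> y < r" if "b \<noteq> \<infinity>" "y \<in> global_minima (\<lambda>y. \<phi> y + real_of_ereal b * \<psi> y)" for y
  proof -
    have "ereal (\<psi> y) \<le> (SUP y\<in>M_set \<phi> \<psi> b. ereal (\<psi> y))"
      using that by (intro SUP_upper) (simp add: M_set_def)
    also have "\<dots> < ereal r" using r(1) assms(10) by simp
    finally show ?thesis by simp
  qed
  have a: "r < \<psi> y" if "y \<in> global_minima (\<lambda>y. \<phi> y + real_of_ereal a * \<psi> y)" for y
  proof -
    have "a \<noteq> \<infinity>" using assms(9) by auto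
    have "ereal r < (INF y\<in>M_set \<phi> \<psi> a. ereal (\<psi> y))" using r(2) assms(11) by simp
    also have "\<dots> \<le> ereal (\<psi> y)"
      using that \<open>a \<noteq> \<infinity>\<close> by (intro INF_lower) (simp add: M_set_def)
    finally show ?thesis by simp
  qed
  obtain l where l: "l \<in> multipliers" "\<psi> (minimizer l) = r"
    using exists_multiplier[OF y0 b a] by blast
  define y1 where "y1 = minimizer l"
  have y1: "\<psi> y1 = r" by (simp add: y1_def l(2))
  have lagrange: "\<phi> y1 + l * r \<le> \<phi> y + l * \<psi> y" for y
    using minimizer_le[OF l(1), of y] y1 by (simp add: y1_def)
  have "(INF y\<in>\<psi> -` {r}. ereal (\<phi> y)) = ereal (\<phi> y1)"
  proof (rule antisym)
    show "(INF y\<in>\<psi> -` {r}. ereal (\<phi> y)) \<le> ereal (\<phi> y1)"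
      using y1 by (intro INF_lower) simp
    show "ereal (\<phi> y1) \<le> (INF y\<in>\<psi> -` {r}. ereal (\<phi> y))"
    proof (rule INF_greatest)
      show "ereal (\<phi> y1) \<le> ereal (\<phi> y)" if "y \<in> \<psi> -` {r}" for y
        using lagrange[of y] that by simp
    qed
  qed
  moreover have "(INF u\<in>V_set M p \<psi> \<gamma> r. extended_integral M (\<lambda>t. \<gamma> t * \<phi> (u t)))
      = ereal (\<phi> y1 * (\<integral>t. \<gamma> t \<partial>M))"
  proof (rule antisym)
    show "(INF u\<in>V_set M p \<psi> \<gamma> r. extended_integral M (\<lambda>t. \<gamma> t * \<phi> (u t)))
        \<le> ereal (\<phi> y1 * (\<integral>t. \<gamma> t \<partial>M))"
    proof (rule ereal_le_epsilon2)
      fix e :: real assume e: "e > 0"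
      obtain u where u: "u \<in> V_set M p \<psi> \<gamma> r"
        "extended_integral M (\<lambda>t. \<gamma> t * \<phi> (u t)) \<le> ereal (\<phi> y1 * (\<integral>t. \<gamma> t \<partial>M)) + ereal e"
        by (rule exists_near_constant_competitor[where \<psi> = \<psi> and \<phi> = \<phi>, OF assms(1) \<gamma>(1,3) y0 y1 e])
      show "(INF u\<in>V_set M p \<psi> \<gamma> r. extended_integral M (\<lambda>t. \<gamma> t * \<phi> (u t)))
          \<le> ereal (\<phi> y1 * (\<integral>t. \<gamma> t \<partial>M)) + ereal e"
        by (intro order_trans[OF _ u(2)] INF_lower u(1))
    qed
    obtain c where c: "c \<ge> 0" "\<And>y. - c * (1 + norm y powr p) \<le> \<phi> y"
      "\<And>y. - c * (1 + norm y powr p) \<le> \<psi> y"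
      by (rule growth_bound[OF assms(7)]) (rule that)
    show "ereal (\<phi> y1 * (\<integral>t. \<gamma> t \<partial>M))
        \<le> (INF u\<in>V_set M p \<psi> \<gamma> r. extended_integral M (\<lambda>t. \<gamma> t * \<phi> (u t)))"
    proof (rule INF_greatest)
      fix u assume "u \<in> V_set M p \<psi> \<gamma> r"
      then have "u \<in> Lp_space p M"
        "extended_integral M (\<lambda>t. \<gamma> t * \<psi> (u t)) \<le> ereal (r * (\<integral>t. \<gamma> t \<partial>M))"
        by (simp_all add: V_set_def)
      then show "ereal (\<phi> y1 * (\<integral>t. \<gamma> t \<partial>M)) \<le> extended_integral M (\<lambda>t. \<gamma> t * \<phi> (u t))"
        by (intro multiplier_lower_bound[OF _ \<gamma> seq_weakly_lsc_borel_measurable[OF assms(5)]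
              seq_weakly_lsc_borel_measurable[OF assms(6)] c less_imp_le[OF multipliers_pos[OF l(1)]] lagrange])
    qed
  qed
  ultimately show "(INF u\<in>V_set M p \<psi> \<gamma> r. extended_integral M (\<lambda>t. \<gamma> t * \<phi> (u t)))
      = (INF y\<in>\<psi> -` {r}. ereal (\<phi> y)) * ereal (\<integral>t. \<gamma> t \<partial>M)"
    by simp
qed

end
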